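(* Define polynomials in $y$: $a_0=-y-5\cdot4y^2-5^2\cdot6y^3-5^3\cdot4y^4-5^4y^5$, $a_1=-5\cdot3y-5\cdot61y^2-5^2\cdot93y^3-5^3\cdot63y^4-5^4\cdot16y^5$, $a_2=-5\cdot17y-5^3\cdot14y^2-5^2\cdot541y^3-5^3\cdot372y^4-5^4\cdot96y^5$, $a_3=-5\cdot43y-5^2\cdot179y^2-5^4\cdot56y^3-5^3\cdot976y^4-5^4\cdot256y^5$, $a_4=-5\cdot41y-5^2\cdot172y^2-5^3\cdot272y^3-5^4\cdot192y^4-5^4\cdot256y^5$, and write $a_j(\tau)$ for $a_j$ evaluated at $y=y(\tau)$. Then \[ y(\tau)^5+\sum_{j=0}^4 a_j(5\tau)\,y(\tau)^j=0. \]
   Context: $q=e^{2\pi i\tau}$ with $\tau$ in the upper half-plane, and $y(\tau)=q\prod_{m\ge1}\frac{(1-q^{2m})(1-q^{10m})^3}{(1-q^m)^3(1-q^{5m})}$. *)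

theory Defs
  imports "HOL-Analysis.Analysis" "HOL-Computational_Algebra.Polynomial"
begin

definition nome :: "complex \<Rightarrow> complex" where
  "nome \<tau> = exp (2 * of_real pi * \<i> * \<tau>)"

text \<open>The library's infinite product starts at index 0, so the factor with index \<open>m \<ge> 1\<close> is
  written with \<open>Suc m\<close>. The definition is only meaningful for \<open>Im \<tau> > 0\<close>, where
  the product converges.\<close>

definition y_fun :: "complex \<Rightarrow> complex" where
  "y_fun \<tau> = (let q = nome \<tau> in
     q * (\<Prod>m. (1 - q ^ (2 * Suc m)) * (1 - q ^ (10 * Suc m)) ^ 3
               / ((1 - q ^ Suc m) ^ 3 * (1 - q ^ (5 * Suc m)))))"

text \<open>The polynomials \<open>a\<^sub>0, \<dots>, a\<^sub>4\<close>; coefficients are listed from the constant term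
  upwards, and every one of them has constant term zero. Indices above 4 are not used.\<close>

definition a_poly :: "nat \<Rightarrow> complex poly" where
  "a_poly j =
    [ [:0, -1,        -(5 * 4),       -(5^2 * 6),   -(5^3 * 4),   -(5^4):],
      [:0, -(5 * 3),  -(5 * 61),      -(5^2 * 93),  -(5^3 * 63),  -(5^4 * 16):],
      [:0, -(5 * 17), -(5^3 * 14),    -(5^2 * 541), -(5^3 * 372), -(5^4 * 96):],
      [:0, -(5 * 43), -(5^2 * 179),   -(5^4 * 56),  -(5^3 * 976), -(5^4 * 256):],
      [:0, -(5 * 41), -(5^2 * 172),   -(5^3 * 272), -(5^4 * 192), -(5^4 * 256):] ] ! j"

definition a_fun :: "nat \<Rightarrow> complex \<Rightarrow> complex" where
  "a_fun j \<tau> = poly (a_poly j) (y_fun \<tau>)"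

end

theory Submission
  imports Defs
begin

text \<open>
  Replacing \<open>q\<close> by \<open>\<zeta> q\<close> for a fifth root of unity \<open>\<zeta>\<close> splits every
  \<open>q\<close>-series into five graded components, and identities may be compared component by component.
  By the Jacobi triple product, Euler's series \<open>E(q) = \<Prod>(1 - q^m)\<close> has only the components
  \<open>0, 1, 2\<close>, its component \<open>1\<close> being \<open>- q E(q^25)\<close>, while
  \<open>E(q)^2 / E(q^2) = \<Sum>(-1)^n q^(n^2)\<close> has only the components \<open>0, 1, 4\<close>, its component \<open>0\<close>
  being the same function at \<open>q^25\<close>. Comparing components in
  \<open>E(q)^2 = (\<Sum>(-1)^n q^(n^2)) E(q^2)\<close> gives
  \<open>E(q) = q E(q^25) (1/u - 1 - u)\<close> and \<open>E(q^2) = q^2 E(q^50) (1/v - 1 - v)\<close>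
  (here \<open>u\<close>, \<open>v\<close> are the Rogers-Ramanujan continued fractions at \<open>q^5\<close>, \<open>q^10\<close>, but this is
  never needed) together with \<open>v - u^2 = u v^2 (v + u^2)\<close>.

  With \<open>k = u v^2\<close> one finds \<open>u^5 = k (1 - k)^2 / (1 + k)^2\<close> and \<open>v = u^2 (1 + k) / (1 - k)\<close>, and
  taking products over the five values \<open>\<zeta>^j q\<close> expresses the eta quotients at \<open>q^5\<close>
  through \<open>k\<close>: in particular \<open>y(q^5) = k / (1 - 4 k - k^2)\<close>. Since also
  \<open>y(q) = (1 + k - k^2) / (1 - k^2) * (1/v - 1 - v) / (1/u - 1 - u)^3\<close>,
  the modular equation becomes an algebraic identity in \<open>u\<close> and \<open>k\<close>.
\<close>

subsection \<open>Infinite \<open>q\<close>-products\<close>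

text \<open>The infinite q-Pochhammer symbol with base \<open>p\<close>. The first argument is kept
  free so that residue classes of factors and twists by roots of unity are again instances of
  it.\<close>

definition qpoch :: "complex \<Rightarrow> complex \<Rightarrow> complex" where
  "qpoch a p = (\<Prod>n. 1 - a * p ^ n)"

text \<open>The Dedekind eta function without its factor of exponent 1/24. As a function of
  \<open>q\<close> alone it can be evaluated at \<open>zeta5 * q\<close>.\<close>

definition euler :: "complex \<Rightarrow> complex" where
  "euler q = qpoch q q"

lemma qpoch_convergent:
  fixes a p :: complex
  assumes "norm p < 1"
  shows "convergent_prod (\<lambda>n. 1 - a * p ^ n)"
proof -
  have "summable (\<lambda>n. norm a * norm p ^ n)"
    using assms by (intro summable_mult summable_geometric) auto
  moreover have "norm (1 - a * p ^ n - 1) = norm a * norm p ^ n" for n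
    by (simp add: norm_mult norm_power)
  ultimately have "abs_convergent_prod (\<lambda>n. 1 - a * p ^ n)"
    unfolding abs_convergent_prod_conv_summable by simp
  thus ?thesis by (rule abs_convergent_prod_imp_convergent_prod)
qed

lemma qpoch_LIMSEQ:
  assumes "norm p < 1"
  shows "(\<lambda>N. \<Prod>n<N. 1 - a * p ^ n) \<longlonglongrightarrow> qpoch a p"
  unfolding qpoch_def
  by (intro has_prod_imp_tendsto' convergent_prod_has_prod qpoch_convergent assms)

lemma qpoch_nonzero:
  assumes "norm p < 1" "norm a < 1"
  shows "qpoch a p \<noteq> 0"
  unfolding qpoch_def
proof (rule prodinf_nonzero[OF qpoch_convergent[OF assms(1)]])
  fix n
  have "norm (a * p ^ n) \<le> norm a * 1"
    unfolding norm_mult norm_power using assms by (intro mult_left_mono power_le_one) auto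
  hence "norm (a * p ^ n) < 1" using assms by simp
  thus "1 - a * p ^ n \<noteq> 0" by auto
qed

lemma euler_nonzero: "norm q < 1 \<Longrightarrow> euler q \<noteq> 0"
  unfolding euler_def by (intro qpoch_nonzero)

lemma euler_power_nonzero: "norm q < 1 \<Longrightarrow> n > 0 \<Longrightarrow> euler (q ^ n) \<noteq> 0"
  by (intro euler_nonzero) (simp add: norm_power power_less_one_iff)

lemma prod_split_residues:
  fixes f :: "nat \<Rightarrow> 'a :: comm_monoid_mult"
  shows "(\<Prod>i<k * N. f i) = (\<Prod>r<k. \<Prod>n<N. f (k * n + r))"
proof -
  have "(\<Prod>i<k * N. f i) = (\<Prod>n<N. \<Prod>r<k. f (k * n + r))"
  proof (induction N)
    case (Suc N)
    have "{..<k * Suc N} = {..<k * N} \<union> {k * N..<k * N + k}" by auto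
    hence "(\<Prod>i<k * Suc N. f i) = (\<Prod>i\<in>{..<k * N} \<union> {k * N..<k * N + k}. f i)"
      by (rule arg_cong)
    also have "\<dots> = (\<Prod>i<k * N. f i) * (\<Prod>i\<in>{k * N..<k * N + k}. f i)"
      by (rule prod.union_disjoint) auto
    also have "(\<Prod>i\<in>{k * N..<k * N + k}. f i) = (\<Prod>r<k. f (k * N + r))"
      by (rule prod.reindex_bij_witness[of _ "\<lambda>r. k * N + r" "\<lambda>i. i - k * N"]) auto
    finally show ?case using Suc by simp
  qed auto
  also have "\<dots> = (\<Prod>r<k. \<Prod>n<N. f (k * n + r))" by (rule prod.swap)
  finally show ?thesis .
qed

text \<open>The first \<open>k * N\<close> factors are grouped by the residue of their index modulo
  \<open>k\<close>; each group is a partial product with base \<open>p ^ k\<close>, and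
  \<open>N\<close> tends to infinity.\<close>

lemma qpoch_split:
  assumes "norm p < 1" "k > 0"
  shows "qpoch a p = (\<Prod>r<k. qpoch (a * p ^ r) (p ^ k))"
proof -
  have pk: "norm (p ^ k) < 1" using assms by (simp add: norm_power power_less_one_iff)
  have "filterlim (\<lambda>N. k * N) at_top sequentially"
    using assms(2) by (intro filterlim_subseq strict_monoI) auto
  from filterlim_compose[OF qpoch_LIMSEQ[OF assms(1)] this]
  have 1: "(\<lambda>N. \<Prod>i<k * N. 1 - a * p ^ i) \<longlonglongrightarrow> qpoch a p" .
  have 2: "(\<Prod>i<k * N. 1 - a * p ^ i) = (\<Prod>r<k. \<Prod>n<N. 1 - (a * p ^ r) * (p ^ k) ^ n)" for N
    unfolding prod_split_residues by (simp add: power_add power_mult [symmetric] mult_ac)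
  have "(\<lambda>N. \<Prod>r<k. \<Prod>n<N. 1 - (a * p ^ r) * (p ^ k) ^ n) \<longlonglongrightarrow> (\<Prod>r<k. qpoch (a * p ^ r) (p ^ k))"
    by (intro tendsto_prod qpoch_LIMSEQ pk)
  with 1 show ?thesis unfolding 2 by (rule LIMSEQ_unique)
qed

lemma euler_prodinf: "euler (q ^ k) = (\<Prod>m. 1 - q ^ (k * Suc m))"
  unfolding euler_def qpoch_def by (simp add: power_add power_mult)

lemma euler_convergent:
  fixes q :: complex
  assumes "norm q < 1" "k > 0"
  shows "convergent_prod (\<lambda>m. 1 - q ^ (k * Suc m))"
proof -
  have "norm (q ^ k) < 1" using assms by (simp add: norm_power power_less_one_iff)
  from qpoch_convergent[OF this, of "q ^ k"] show ?thesis
    by (simp add: power_add power_mult [symmetric])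
qed

text \<open>As an eta quotient this has total exponent (2 + 3 * 10 - 3 * 1 - 5) / 24 = 1, which
  accounts for the leading factor \<open>q\<close>.\<close>

definition eta_y :: "complex \<Rightarrow> complex" where
  "eta_y q = q * euler (q ^ 2) * euler (q ^ 10) ^ 3 / (euler q ^ 3 * euler (q ^ 5))"

lemma norm_nome: "Im \<tau> > 0 \<Longrightarrow> norm (nome \<tau>) < 1"
  by (simp add: nome_def mult_pos_pos)

lemma y_fun_eq_eta_y:
  assumes "Im \<tau> > 0"
  shows "y_fun \<tau> = eta_y (nome \<tau>)"
proof -
  define q where "q = nome \<tau>"
  have q: "norm q < 1" unfolding q_def by (rule norm_nome[OF assms])
  note c = euler_convergent[OF q]
  have 1: "euler q = (\<Prod>m. 1 - q ^ Suc m)" "convergent_prod (\<lambda>m. 1 - q ^ Suc m)"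
    using euler_prodinf[of q 1] c[of 1] by simp_all
  have "eta_y q = q * ((\<Prod>m. 1 - q ^ (2 * Suc m)) * (\<Prod>m. 1 - q ^ (10 * Suc m)) ^ 3
                 / ((\<Prod>m. 1 - q ^ Suc m) ^ 3 * (\<Prod>m. 1 - q ^ (5 * Suc m))))"
    unfolding eta_y_def 1(1) euler_prodinf by simp
  also have "\<dots> = q * (\<Prod>m. (1 - q ^ (2 * Suc m)) * (1 - q ^ (10 * Suc m)) ^ 3
                            / ((1 - q ^ Suc m) ^ 3 * (1 - q ^ (5 * Suc m))))"
    by (simp only: prodinf_divide prodinf_mult prodinf_power [symmetric]
          convergent_prod_mult convergent_prod_power c 1(2) zero_less_numeral)
  finally show ?thesis by (simp only: y_fun_def Let_def q_def)
qed

subsection \<open>The Jacobi triple product\<close>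

text \<open>The product \<open>n * (n - 1)\<close> is nonnegative for every integer
  \<open>n\<close>, so \<open>nat\<close> loses nothing and the value can serve as a natural
  exponent.\<close>

definition tri :: "int \<Rightarrow> nat" where
  "tri n = nat (n * (n - 1) div 2)"

lemma tri_double: "2 * int (tri n) = n * (n - 1)"
proof -
  have "n * (n - 1) \<ge> 0"
    by (cases "n \<ge> 1") (auto intro: mult_nonpos_nonpos)
  moreover have "even (n * (n - 1))" by auto
  ultimately show ?thesis unfolding tri_def by auto
qed

lemma tri_eqI: "2 * int m = n * (n - 1) \<Longrightarrow> tri n = m"
  using tri_double[of n] by linarith

lemma tri_int_Suc: "tri (int (Suc k)) = tri (int k) + k"
  by (rule tri_eqI) (use tri_double[of "int k"] in \<open>simp add: algebra_simps\<close>)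

definition theta_term :: "complex \<Rightarrow> complex \<Rightarrow> int \<Rightarrow> complex" where
  "theta_term x p n = (-x) powi n * p ^ tri n"

section \<open>Gaussian binomial coefficients and the finite q-binomial theorem\<close>

definition qfact :: "complex \<Rightarrow> nat \<Rightarrow> complex" where
  "qfact p M = (\<Prod>i<M. 1 - p ^ Suc i)"

text \<open>The Gaussian binomial coefficient. The value 0 for \<open>k > M\<close> allows summation
  ranges to be extended freely.\<close>

definition qbinom :: "complex \<Rightarrow> nat \<Rightarrow> nat \<Rightarrow> complex" where
  "qbinom p M k = (if k \<le> M then qfact p M / (qfact p k * qfact p (M - k)) else 0)"

lemma one_minus_power_nonzero:
  fixes p :: complex
  assumes "norm p < 1"
  shows "1 - p ^ Suc i \<noteq> 0"
proof
  assume "1 - p ^ Suc i = 0"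
  hence "norm p ^ Suc i = 1" by (metis norm_one norm_power right_minus_eq)
  moreover have "norm p ^ Suc i < 1" using assms mult_left_le[of "norm p ^ i" "norm p"]
    by (auto simp: power_le_one intro: le_less_trans)
  ultimately show False by simp
qed

lemma qfact_nonzero: "norm p < 1 \<Longrightarrow> qfact p M \<noteq> 0"
  unfolding qfact_def using one_minus_power_nonzero by simp

lemma qfact_Suc: "qfact p (Suc M) = qfact p M * (1 - p ^ Suc M)"
  by (simp add: qfact_def)

lemma qbinom_0: "norm p < 1 \<Longrightarrow> qbinom p M 0 = 1"
  using qfact_nonzero[of p M] by (simp add: qbinom_def qfact_def)

text \<open>The q-Pascal rule. For \<open>M = k + Suc d\<close> it comes from \<open>1 - p ^ Suc M =
  (1 - p ^ Suc d) + p ^ Suc d * (1 - p ^ Suc k)\<close>.\<close>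

lemma qbinom_Suc_Suc:
  assumes "norm p < 1" "k \<le> M"
  shows "qbinom p (Suc M) (Suc k) = qbinom p M (Suc k) + p ^ (M - k) * qbinom p M k"
proof (cases "k = M")
  case True
  have "qfact p (Suc M) \<noteq> 0" "qfact p M \<noteq> 0" "qfact p 0 = 1"
    using qfact_nonzero assms by (auto simp: qfact_def)
  thus ?thesis using True by (simp add: qbinom_def)
next
  case False
  then obtain d where M: "M = k + Suc d" using assms(2) less_iff_Suc_add
    by (metis add_Suc_right le_neq_implies_less)
  have nz: "qfact p k \<noteq> 0" "qfact p d \<noteq> 0" "1 - p ^ Suc k \<noteq> 0" "1 - p ^ Suc d \<noteq> 0"
    using qfact_nonzero one_minus_power_nonzero assms by blast+
  have *: "(1 - p ^ Suc M) / ((1 - p ^ Suc k) * (1 - p ^ Suc d)) =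
        1 / (1 - p ^ Suc k) + p ^ Suc d / (1 - p ^ Suc d)"
    using nz by (simp add: divide_simps) (simp add: M algebra_simps power_add)
  have "qbinom p (Suc M) (Suc k) = qfact p M / (qfact p k * qfact p d) *
      ((1 - p ^ Suc M) / ((1 - p ^ Suc k) * (1 - p ^ Suc d)))"
    by (simp add: qbinom_def M qfact_Suc del: power_Suc)
  also have "\<dots> = qbinom p M (Suc k) + p ^ (M - k) * qbinom p M k"
    unfolding * using nz
      by (simp add: qbinom_def M qfact_Suc del: power_Suc) (simp add: divide_simps, simp add: algebra_simps)
  finally show ?thesis .
qed

lemma q_binomial_theorem:
  assumes "norm p < 1"
  shows "(\<Prod>i<M. 1 - t * p ^ i) = (\<Sum>k\<le>M. qbinom p M k * ((-t) ^ k * p ^ tri (int k)))"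
proof (induction M)
  case 0
  show ?case using qbinom_0[OF assms, of 0] by (simp add: tri_def)
next
  case (Suc M)
  define c where "c k = (-t) ^ k * p ^ tri (int k)" for k
  \<comment> \<open>The second term of the q-Pascal rule thus reproduces the old sum times
    \<open>-t * p ^ M\<close>, which is what the new factor \<open>1 - t * p ^ M\<close>
    contributes.\<close>
  have c: "p ^ (M - k) * c (Suc k) = -t * p ^ M * c k" if "k \<le> M" for k
  proof -
    have "p ^ (M - k) * c (Suc k) = -t * (p ^ (M - k) * p ^ k) * c k"
      unfolding c_def tri_int_Suc power_add by simp
    also have "p ^ (M - k) * p ^ k = p ^ M" using that by (metis le_add_diff_inverse2 power_add)
    finally show ?thesis by simp
  qed
  have "(\<Sum>k\<le>Suc M. qbinom p (Suc M) k * c k) =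
      c 0 + (\<Sum>k\<le>M. qbinom p (Suc M) (Suc k) * c (Suc k))"
    by (subst sum.atMost_Suc_shift) (simp add: qbinom_0[OF assms])
  also have "(\<Sum>k\<le>M. qbinom p (Suc M) (Suc k) * c (Suc k)) =
      (\<Sum>k\<le>M. qbinom p M (Suc k) * c (Suc k) + -t * p ^ M * (qbinom p M k * c k))"
  proof (intro sum.cong refl)
    fix k assume "k \<in> {..M}"
    hence k: "k \<le> M" by simp
    have "qbinom p M k * (p ^ (M - k) * c (Suc k)) = -t * p ^ M * (qbinom p M k * c k)"
      unfolding c[OF k] by simp
    thus "qbinom p (Suc M) (Suc k) * c (Suc k) = qbinom p M (Suc k) * c (Suc k)
      + -t * p ^ M * (qbinom p M k * c k)"
      by (simp add: qbinom_Suc_Suc[OF assms k] ring_distribs mult_ac)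
  qed
  also have "c 0 + \<dots> = (\<Sum>k\<le>Suc M. qbinom p M k * c k) - t * p ^ M * (\<Sum>k\<le>M. qbinom p M k * c k)"
    by (subst sum.atMost_Suc_shift)
       (simp add: qbinom_0[OF assms] sum_subtractf sum_distrib_left)
  also have "(\<Sum>k\<le>Suc M. qbinom p M k * c k) = (\<Sum>k\<le>M. qbinom p M k * c k)"
    by (simp add: qbinom_def)
  finally show ?case using Suc by (simp add: c_def algebra_simps)
qed

lemma prod_lessThan_add:
  fixes f :: "nat \<Rightarrow> 'a :: comm_monoid_mult"
  shows "(\<Prod>i<M + N. f i) = (\<Prod>i<M. f i) * (\<Prod>n<N. f (M + n))"
  by (induction N) (simp_all add: mult_ac)

text \<open>These are the factors \<open>1 - x * p ^ n\<close> with \<open>n\<close> from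
  \<open>-N\<close> to -1. Each is turned around by
  \<open>1 - x / p ^ n = - (x / p ^ n) * (1 - p ^ n / x)\<close>; the collected power of
  \<open>p\<close> stays on the left to avoid negative exponents.\<close>

lemma prod_negative_range:
  fixes x p :: complex
  assumes "p \<noteq> 0" "x \<noteq> 0"
  shows "(\<Prod>i<N. 1 - x / p ^ N * p ^ i) * p ^ tri (int (Suc N)) = (-x) ^ N * (\<Prod>n<N. 1
    - p / x * p ^ n)"
proof (induction N)
  case (Suc N)
  define A where "A = (\<Prod>i<N. 1 - x / p ^ N * p ^ i)"
  define B where "B = (\<Prod>n<N. 1 - p / x * p ^ n)"
  have 1: "(1 - x / p ^ Suc N) * p ^ Suc N = (-x) * (1 - p / x * p ^ N)"
    using assms by (simp add: field_simps)
  have "x / p ^ Suc N * p ^ Suc i = x / p ^ N * p ^ i" for i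
    using assms by simp
  hence "(\<Prod>i<Suc N. 1 - x / p ^ Suc N * p ^ i) = (1 - x / p ^ Suc N) * A"
    unfolding A_def by (subst prod.lessThan_Suc_shift) simp
  hence "(\<Prod>i<Suc N. 1 - x / p ^ Suc N * p ^ i) * p ^ tri (int (Suc (Suc N))) =
      ((1 - x / p ^ Suc N) * p ^ Suc N) * (A * p ^ tri (int (Suc N)))"
    unfolding tri_int_Suc[of "Suc N"] power_add by (simp only: mult_ac)
  also have "\<dots> = (-x) ^ Suc N * (B * (1 - p / x * p ^ N))"
    unfolding 1 using Suc by (simp add: A_def B_def mult_ac)
  finally show ?case by (simp add: B_def)
qed (simp add: tri_def)

text \<open>The q-binomial theorem with \<open>2 * N\<close> factors at \<open>t = x / p ^ N\<close>
  gives a product centred at exponent 0. Its lower half is reflected by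
  \<open>prod_negative_range\<close>, and the summation index is shifted by
  \<open>N\<close>.\<close>

lemma finite_jacobi_triple:
  fixes x p :: complex
  assumes "norm p < 1" "p \<noteq> 0" "x \<noteq> 0"
  shows "(\<Prod>n<N. 1 - x * p ^ n) * (\<Prod>n<N. 1 - p / x * p ^ n) =
    (\<Sum>k\<le>2 * N. qbinom p (2 * N) k * theta_term x p (int k - int N))"
proof -
  define R where "R = (\<Prod>n<N. 1 - p / x * p ^ n)"
  define L where "L = (\<Prod>n<N. 1 - x * p ^ n)"
  have "(\<Prod>i<2 * N. 1 - x / p ^ N * p ^ i) = (\<Prod>i<N. 1 - x / p ^ N * p ^ i) * (\<Prod>n<N. 1
    - x / p ^ N * p ^ (N + n))"
    by (simp only: mult_2 prod_lessThan_add)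
  also have "(\<Prod>n<N. 1 - x / p ^ N * p ^ (N + n)) = L"
    unfolding L_def using assms by (simp add: power_add)
  finally have "(-x) ^ N * R * L = (\<Prod>i<2 * N. 1 - x / p ^ N * p ^ i) * p ^ tri (int (Suc N))"
    using prod_negative_range[OF assms(2,3), of N] by (simp add: R_def mult_ac)
  also have "\<dots> =
    (\<Sum>k\<le>2 * N. qbinom p (2 * N) k * ((- (x / p ^ N)) ^ k * p ^ tri (int k) * p ^ tri (int (Suc N))))"
    unfolding q_binomial_theorem[OF assms(1)] by (simp only: sum_distrib_left mult_ac)
  also have "\<dots> = (\<Sum>k\<le>2 * N. (-x) ^ N * (qbinom p (2 * N) k * theta_term x p (int k - int N)))"
  proof (intro sum.cong refl)
    fix k
    \<comment> \<open>Completing the exponents: doubled, both sides are polynomials in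
      \<open>k\<close> and \<open>N\<close>.\<close>
    have "2 * int (tri (int k) + tri (int (Suc N))) = 2 * int (N * k + tri (int k - int N))"
      unfolding of_nat_add distrib_left tri_double by (simp add: algebra_simps)
    hence "tri (int k) + tri (int (Suc N)) = N * k + tri (int k - int N)"
      by (simp only: mult_cancel_left of_nat_eq_iff) simp
    hence e: "p ^ tri (int k) * p ^ tri (int (Suc N)) = p ^ (N * k) * p ^ tri (int k - int N)"
      by (simp add: power_add [symmetric])
    have "(-x) ^ N * theta_term x p (int k - int N) = (-x) ^ k * p ^ tri (int k - int N)"
      using assms by (simp add: theta_term_def power_int_diff)
    also have "\<dots> = (- (x / p ^ N)) ^ k * (p ^ (N * k) * p ^ tri (int k - int N))"
      using assms by (simp add: power_mult power_divide power_minus[of "x / _"] power_minus[of x])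
    finally have "(- (x / p ^ N)) ^ k * (p ^ tri (int k) * p ^ tri (int (Suc N))) =
        (-x) ^ N * theta_term x p (int k - int N)" unfolding e ..
    thus "qbinom p (2 * N) k * ((- (x / p ^ N)) ^ k * p ^ tri (int k) * p ^ tri (int (Suc N))) =
        (-x) ^ N * (qbinom p (2 * N) k * theta_term x p (int k - int N))"
      by (simp only: mult.assoc mult.left_commute[of _ "qbinom p (2 * N) k"])
  qed
  also have "\<dots> = (-x) ^ N * (\<Sum>k\<le>2 * N. qbinom p (2 * N) k * theta_term x p (int k - int N))"
    by (simp add: sum_distrib_left)
  finally show ?thesis using assms by (simp add: R_def L_def mult_ac)
qed

section \<open>Absolute convergence of bilateral theta series\<close>

lemma summable_norm_geometric_ratio:
  fixes f :: "nat \<Rightarrow> complex"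
  assumes "norm p < 1" "\<And>k. f (Suc k) = f k * (c * p ^ k)"
  shows "summable (\<lambda>k. norm (f k))"
proof -
  have "(\<lambda>k. norm c * norm p ^ k) \<longlonglongrightarrow> norm c * 0"
    using assms by (intro tendsto_intros LIMSEQ_power_zero) auto
  hence "eventually (\<lambda>k. norm c * norm p ^ k < 1/2) sequentially"
    by (intro order_tendstoD) auto
  then obtain N where N: "\<And>k. k \<ge> N \<Longrightarrow> norm c * norm p ^ k < 1/2"
    by (auto simp: eventually_at_top_linorder)
  show ?thesis
  proof (rule summable_ratio_test[where c = "1/2" and N = N])
    fix k assume "k \<ge> N"
    have "norm (f (Suc k)) = norm c * norm p ^ k * norm (f k)"
      unfolding assms(2) by (simp add: norm_mult norm_power mult_ac)
    also have "\<dots> \<le> 1/2 * norm (f k)"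
      using N[OF \<open>k \<ge> N\<close>] by (intro mult_right_mono) auto
    finally show "norm (norm (f (Suc k))) \<le> 1/2 * norm (norm (f k))" by simp
  qed auto
qed

text \<open>Pairing \<open>n = k\<close> with \<open>n = - k - 1\<close> covers every integer once
  and turns the bilateral sum into a series over the naturals, to which limit theorems for series
  apply.\<close>

lemma has_sum_int_split:
  fixes f :: "int \<Rightarrow> complex"
  assumes "summable (\<lambda>k. norm (f (int k)))" "summable (\<lambda>k. norm (f (- int k - 1)))"
  shows "(f has_sum (\<Sum>k. f (int k) + f (- int k - 1))) UNIV"
proof -
  have 1: "((\<lambda>k. f (int k)) has_sum (\<Sum>k. f (int k))) UNIV"
    by (rule norm_summable_imp_has_sum[OF assms(1) summable_sums[OF summable_norm_cancel[OF assms(1)]]])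
  have 2: "((\<lambda>k. f (- int k - 1)) has_sum (\<Sum>k. f (- int k - 1))) UNIV"
    by (rule norm_summable_imp_has_sum[OF assms(2) summable_sums[OF summable_norm_cancel[OF assms(2)]]])
  have "(f has_sum (\<Sum>k. f (int k))) {0..}"
    using 1 by (rule has_sum_reindex_bij_witness[of _ nat int, THEN iffD1, rotated -1]) auto
  moreover have "(f has_sum (\<Sum>k. f (- int k - 1))) {..<0}"
    using 2 by (rule has_sum_reindex_bij_witness[of _ "\<lambda>n. nat (- n - 1)" "\<lambda>k. - int k
      - 1", THEN iffD1, rotated -1]) auto
  ultimately have "(f has_sum ((\<Sum>k. f (int k)) + (\<Sum>k. f (- int k - 1)))) ({0..} \<union> {..<0})"
    by (rule has_sum_Un_disjoint) auto
  also have "{0..} \<union> {..<0} = (UNIV :: int set)" by auto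
  also have "(\<Sum>k. f (int k)) + (\<Sum>k. f (- int k - 1)) = (\<Sum>k. f (int k) + f (- int k - 1))"
    by (rule suminf_add [OF summable_norm_cancel[OF assms(1)] summable_norm_cancel[OF assms(2)]])
  finally show ?thesis .
qed

lemma tri_neg_Suc: "tri (- int (Suc k) - 1) = tri (- int k - 1) + (k + 2)"
  by (rule tri_eqI) (use tri_double[of "- int k - 1"] in \<open>simp add: algebra_simps\<close>)

lemma summable_theta_term:
  assumes "norm p < 1" "x \<noteq> 0"
  shows "summable (\<lambda>k. norm (theta_term x p (int k)))"
    and "summable (\<lambda>k. norm (theta_term x p (- int k - 1)))"
proof -
  show "summable (\<lambda>k. norm (theta_term x p (int k)))"
  proof (rule summable_norm_geometric_ratio[OF assms(1)])
    fix k show "theta_term x p (int (Suc k)) = theta_term x p (int k) * (- x * p ^ k)"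
      unfolding theta_term_def tri_int_Suc power_add power_int_of_nat by simp
  qed
  show "summable (\<lambda>k. norm (theta_term x p (- int k - 1)))"
  proof (rule summable_norm_geometric_ratio[OF assms(1)])
    fix k
    have "(-x) powi (- int (Suc k) - 1) = (-x) powi (- int k - 1) / (-x)"
      using assms(2) power_int_diff[of "-x" "- int k - 1" 1] by (simp add: algebra_simps)
    thus "theta_term x p (- int (Suc k) - 1) = theta_term x p (- int k - 1) * (- p\<^sup>2 / x * p ^ k)"
      unfolding theta_term_def tri_neg_Suc power_add by simp
  qed
qed

lemma qfact_LIMSEQ: "norm p < 1 \<Longrightarrow> qfact p \<longlonglongrightarrow> euler p"
  using qpoch_LIMSEQ[of p p] unfolding qfact_def[abs_def] euler_def by simp

text \<open>The sequence \<open>qfact p\<close> converges to the nonzero number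
  \<open>euler p\<close>, so it and its reciprocal are bounded. The bound is uniform in
  \<open>M\<close> and \<open>k\<close>, as needed for dominated convergence.\<close>

lemma qbinom_bounded:
  assumes "norm p < 1"
  shows "\<exists>C. \<forall>M k. norm (qbinom p M k) \<le> C"
proof -
  have "Bseq (qfact p)" "Bseq (\<lambda>M. inverse (qfact p M))"
    using qfact_LIMSEQ[OF assms] euler_nonzero[OF assms]
    by (auto intro!: convergent_imp_Bseq convergentI tendsto_intros)
  then obtain C D where C: "C > 0" "\<And>M. norm (qfact p M) \<le> C" and D: "D > 0" "\<And>M. norm (inverse (qfact p M)) \<le> D"
    by (auto simp: Bseq_def)
  have "norm (qbinom p M k) \<le> C * (D * D)" for M k
  proof -
    have "qbinom p M k = 0 \<or> qbinom p M k = qfact p M * (inverse (qfact p k) * inverse (qfact p (M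
      - k)))"
      by (simp add: qbinom_def divide_inverse)
    thus ?thesis
      by (elim disjE; simp only: norm_mult norm_zero) (use C D in \<open>auto intro!: mult_mono\<close>)
  qed
  thus ?thesis by blast
qed

lemma qbinom_LIMSEQ:
  assumes "norm p < 1" "filterlim f at_top sequentially" "filterlim g at_top sequentially"
  shows "(\<lambda>N. qbinom p (f N + g N) (f N)) \<longlonglongrightarrow> 1 / euler p"
proof -
  note l = filterlim_compose[OF qfact_LIMSEQ[OF assms(1)]]
  have fg: "filterlim (\<lambda>N. f N + g N) at_top sequentially"
    by (rule filterlim_at_top_mono[OF assms(2)]) auto
  have "(\<lambda>N. qfact p (f N + g N) / (qfact p (f N) * qfact p (g N))) \<longlonglongrightarrow> euler p / (euler p * euler p)"
    using euler_nonzero[OF assms(1)]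
    by (intro tendsto_intros l assms fg) auto
  thus ?thesis using euler_nonzero[OF assms(1)] by (simp add: qbinom_def)
qed

text \<open>The finite identity passes to the limit by Tannery's theorem: every coefficient
  \<open>qbinom p (2 * N) (n + N)\<close> tends to \<open>1 / euler p\<close>, under a common
  bound.\<close>

theorem jacobi_triple_product:
  assumes "norm p < 1" "p \<noteq> 0" "x \<noteq> 0"
  shows "(theta_term x p has_sum (qpoch x p * qpoch (p / x) p * euler p)) UNIV"
proof -
  define \<tau> where "\<tau> = theta_term x p"
  \<comment> \<open>The guard matters: for \<open>n + int N < 0\<close> the function
    \<open>nat\<close> would give 0, where the q-binomial coefficient is 1 and not 0.\<close>
  define h where "h N n = (if - int N \<le> n then qbinom p (2 * N) (nat (n + int N)) else 0)" for N n
  define S where "S = (\<Sum>k. \<tau> (int k) + \<tau> (- int k - 1))"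
  have sum: "summable (\<lambda>k. norm (\<tau> (int k)))" "summable (\<lambda>k. norm (\<tau> (- int k - 1)))"
    unfolding \<tau>_def by (rule summable_theta_term[OF assms(1,3)])+
  have S: "(\<tau> has_sum S) UNIV"
    unfolding S_def by (rule has_sum_int_split[OF sum])
  define a where "a k N = h N (int k) * \<tau> (int k) + h N (- int k - 1) * \<tau> (- int k - 1)" for k N
  obtain C where C: "\<And>M k. norm (qbinom p M k) \<le> C" using qbinom_bounded[OF assms(1)] by blast
  \<comment> \<open>The vanishing coefficient \<open>qbinom p 0 1\<close> shows that
    \<open>C\<close> is nonnegative, which covers the case where \<open>h\<close> is 0.\<close>
  have hC: "norm (h N n) \<le> C" for N n
    using C[of "2 * N" "nat (n + int N)"] C[of 0 1] by (auto simp: h_def qbinom_def)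
  have sa: "(\<Sum>k. a k N) = (\<Prod>n<N. 1 - x * p ^ n) * (\<Prod>n<N. 1 - p / x * p ^ n)" for N
  proof -
    have h0: "h N n = 0" if "n \<notin> {- int N..int N}" for n
      using that by (auto simp: h_def qbinom_def)
    have "(\<Sum>k. a k N) = (\<Sum>k\<le>N. a k N)"
      by (rule suminf_finite) (auto simp: a_def h0)
    also have "\<dots> = (\<Sum>k\<le>N. h N (int k) * \<tau> (int k)) + (\<Sum>k\<le>N. h N (- int k - 1) * \<tau> (- int k - 1))"
      by (simp add: a_def sum.distrib)
    also have "(\<Sum>k\<le>N. h N (int k) * \<tau> (int k)) = (\<Sum>n\<in>{0..int N}. h N n * \<tau> n)"
      by (rule sum.reindex_bij_witness[of _ nat int]) auto
    \<comment> \<open>The range reaches one index too far, to \<open>- int N - 1\<close>; the term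
      there is 0.\<close>
    also have "(\<Sum>k\<le>N. h N (- int k - 1) * \<tau> (- int k - 1)) = (\<Sum>n\<in>{- int N - 1..-1}. h N n * \<tau> n)"
      by (rule sum.reindex_bij_witness[of _ "\<lambda>n. nat (- n - 1)" "\<lambda>k. - int k - 1"]) auto
    also have "(\<Sum>n\<in>{0..int N}. h N n * \<tau> n) + \<dots> = (\<Sum>n\<in>{0..int N} \<union> {- int N - 1..-1}. h N n * \<tau> n)"
      by (rule sum.union_disjoint [symmetric]) auto
    also have "\<dots> = (\<Sum>n\<in>{- int N..int N}. h N n * \<tau> n)"
      by (rule sum.mono_neutral_right) (auto simp: h0)
    also have "\<dots> = (\<Sum>k\<le>2 * N. qbinom p (2 * N) k * \<tau> (int k - int N))"
      by (rule sum.reindex_bij_witness[of _ "\<lambda>k. int k - int N" "\<lambda>n. nat (n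
        + int N)"]) (auto simp: h_def)
    finally show ?thesis unfolding \<tau>_def using finite_jacobi_triple[OF assms] by simp
  qed
  have hlim: "(\<lambda>N. h N n) \<longlonglongrightarrow> 1 / euler p" for n
  proof -
    have f: "filterlim (\<lambda>N. nat (n + int N)) at_top sequentially" for n
      unfolding filterlim_at_top
    proof
      fix l show "eventually (\<lambda>N. l \<le> nat (n + int N)) sequentially"
        using eventually_ge_at_top[of "nat (int l - n)"] by eventually_elim auto
    qed
    have "(\<lambda>N. qbinom p (nat (n + int N) + nat (- n + int N)) (nat (n + int N))) \<longlonglongrightarrow> 1 / euler p"
      by (intro qbinom_LIMSEQ assms(1) f)
    moreover have "eventually (\<lambda>N. qbinom p (nat (n + int N) + nat (- n + int N)) (nat (n
      + int N)) = h N n) sequentially"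
      using eventually_ge_at_top[of "nat \<bar>n\<bar>"]
    proof eventually_elim
      case (elim N)
      hence "nat (n + int N) + nat (- n + int N) = 2 * N" by auto
      thus ?case using elim by (simp add: h_def)
    qed
    ultimately show ?thesis by (rule Lim_transform_eventually)
  qed
  have "(\<lambda>N. \<Sum>k. a k N) \<longlonglongrightarrow> (\<Sum>k. 1 / euler p * \<tau> (int k) + 1 / euler p * \<tau> (- int k - 1))"
  proof (rule tannerys_theorem[THEN conjunct2, THEN conjunct2])
    show "(\<lambda>N. a k N) \<longlonglongrightarrow> 1 / euler p * \<tau> (int k) + 1 / euler p * \<tau> (- int k - 1)" for k
      unfolding a_def by (intro tendsto_intros hlim)
    have "norm (a k N) \<le> C * (norm (\<tau> (int k)) + norm (\<tau> (- int k - 1)))" for k N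
      unfolding a_def distrib_left
      by (intro order.trans[OF norm_triangle_ineq] add_mono) (simp_all add: norm_mult mult_right_mono hC)
    thus "eventually (\<lambda>(k, N). norm (a k N) \<le> C * (norm (\<tau> (int k)) + norm (\<tau> (- int k
      - 1)))) (at_top \<times>\<^sub>F sequentially)"
      by (intro always_eventually) auto
    show "summable (\<lambda>k. C * (norm (\<tau> (int k)) + norm (\<tau> (- int k - 1))))"
      by (intro summable_mult summable_add sum)
  qed auto
  also have "(\<Sum>k. 1 / euler p * \<tau> (int k) + 1 / euler p * \<tau> (- int k - 1)) = 1 / euler p * S"
    unfolding S_def distrib_left [symmetric]
    by (intro suminf_mult summable_add summable_norm_cancel[OF sum(1)] summable_norm_cancel[OF sum(2)])
  finally have "(\<lambda>N. (\<Prod>n<N. 1 - x * p ^ n) * (\<Prod>n<N. 1 - p / x * p ^ n)) \<longlonglongrightarrow> 1 / euler p * S"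
    unfolding sa .
  moreover have "(\<lambda>N. (\<Prod>n<N. 1 - x * p ^ n) * (\<Prod>n<N. 1
    - p / x * p ^ n)) \<longlonglongrightarrow> qpoch x p * qpoch (p / x) p"
    by (intro tendsto_mult qpoch_LIMSEQ assms)
  ultimately have "1 / euler p * S = qpoch x p * qpoch (p / x) p" by (rule LIMSEQ_unique)
  hence "S = qpoch x p * qpoch (p / x) p * euler p"
    using euler_nonzero[OF assms(1)] by (simp add: field_simps)
  with S show ?thesis by (simp add: \<tau>_def)
qed

section \<open>Functional equations of the theta product\<close>

definition theta :: "complex \<Rightarrow> complex \<Rightarrow> complex" where
  "theta x p = qpoch x p * qpoch (p / x) p * euler p"

lemma qpoch_head:
  assumes "norm p < 1"
  shows "qpoch a p = (1 - a) * qpoch (a * p) p"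
proof -
  have "(\<lambda>N. \<Prod>n<Suc N. 1 - a * p ^ n) \<longlonglongrightarrow> qpoch a p"
    by (rule LIMSEQ_Suc[OF qpoch_LIMSEQ[OF assms]])
  moreover have "(\<Prod>n<Suc N. 1 - a * p ^ n) = (1 - a) * (\<Prod>n<N. 1 - a * p * p ^ n)" for N
    by (subst prod.lessThan_Suc_shift) (simp add: mult_ac)
  ultimately have "(\<lambda>N. (1 - a) * (\<Prod>n<N. 1 - a * p * p ^ n)) \<longlonglongrightarrow> qpoch a p" by simp
  moreover have "(\<lambda>N. (1 - a) * (\<Prod>n<N. 1 - a * p * p ^ n)) \<longlonglongrightarrow> (1 - a) * qpoch (a * p) p"
    by (intro tendsto_mult tendsto_const qpoch_LIMSEQ assms)
  ultimately show ?thesis by (rule LIMSEQ_unique)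
qed

lemma theta_reflect: "x \<noteq> 0 \<Longrightarrow> p \<noteq> 0 \<Longrightarrow> theta (p / x) p = theta x p"
  by (simp add: theta_def)

text \<open>Multiplying \<open>x\<close> by \<open>p\<close> loses the factor \<open>1 - x\<close>
  and gains \<open>1 - 1 / x\<close>, and their quotient is \<open>- 1 / x\<close>.\<close>

lemma theta_shift:
  assumes "norm p < 1" "p \<noteq> 0" "x \<noteq> 0"
  shows "theta (x * p) p = - theta x p / x"
proof -
  have "theta (x * p) p = qpoch (x * p) p * qpoch (1 / x) p * euler p"
    using assms by (simp add: theta_def)
  also have "qpoch (1 / x) p = (1 - 1 / x) * qpoch (p / x) p"
    using qpoch_head[OF assms(1), of "1 / x"] by simp
  also have "qpoch (x * p) p * ((1 - 1 / x) * qpoch (p / x) p) * euler p =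
      - ((1 - x) * qpoch (x * p) p * qpoch (p / x) p * euler p) / x"
    using assms by (simp add: field_simps)
  also have "(1 - x) * qpoch (x * p) p = qpoch x p"
    by (rule qpoch_head[OF assms(1), symmetric])
  finally show ?thesis by (simp add: theta_def)
qed

subsection \<open>Dissection into residue classes modulo 5\<close>

lemma has_sum_int_residues:
  fixes f :: "int \<Rightarrow> complex"
  assumes "\<And>j. j < k \<Longrightarrow> ((\<lambda>m. f (int k * m + int j)) has_sum S j) UNIV" "k > 0"
  shows "(f has_sum (\<Sum>j<k. S j)) UNIV"
proof -
  have "(f has_sum (\<Sum>j<n. S j)) {i. i mod int k < int n}" if "n \<le> k" for n
    using that
  proof (induction n)
    case 0
    have "{i. i mod int k < 0} = {}" using assms(2) by (auto simp: not_less)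
    thus ?case by simp
  next
    case (Suc n)
    have "bij_betw (\<lambda>m. int k * m + int n) UNIV {i. i mod int k = int n}"
    proof (rule bij_betwI[where g = "\<lambda>i. i div int k"])
      show "int k * (i div int k) + int n = i" if "i \<in> {i. i mod int k = int n}" for i
        using that mult_div_mod_eq[of "int k" i] by simp
    qed (use Suc.prems in auto)
    hence "(f has_sum S n) {i. i mod int k = int n}"
      using assms(1)[of n] Suc.prems has_sum_reindex_bij_betw[of "\<lambda>m. int k * m
        + int n" UNIV _ f "S n"] by simp
    moreover have "(f has_sum (\<Sum>j<n. S j)) {i. i mod int k < int n}" using Suc by simp
    ultimately have "(f has_sum ((\<Sum>j<n. S j) + S n)) ({i. i mod int k < int n} \<union> {i. i mod int k =
      int n})"
      by (intro has_sum_Un_disjoint) auto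
    also have "{i. i mod int k < int n} \<union> {i. i mod int k = int n} =
      {i. i mod int k < int (Suc n)}" by auto
    finally show ?case by simp
  qed
  from this[of k] have "(f has_sum (\<Sum>j<k. S j)) {i. i mod int k < int k}" by simp
  also have "{i. i mod int k < int k} = UNIV" using assms(2) by auto
  finally show ?thesis .
qed

text \<open>If the terms in each residue class modulo \<open>k\<close> form a theta series again,
  the triple product evaluates the whole and every class.\<close>

lemma theta_dissection:
  assumes "\<And>j m. j < k \<Longrightarrow> theta_term x p (int k * m + int j) = c j * theta_term (y j) r m"
    and "norm p < 1" "p \<noteq> 0" "x \<noteq> 0" "norm r < 1" "r \<noteq> 0" "\<And>j. y j \<noteq> 0" "k > 0"
  shows "theta x p = (\<Sum>j<k. c j * theta (y j) r)"
proof -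
  have "(theta_term x p has_sum (\<Sum>j<k. c j * theta (y j) r)) UNIV"
  proof (rule has_sum_int_residues[OF _ \<open>k > 0\<close>])
    fix j assume "j < k"
    thus "((\<lambda>m. theta_term x p (int k * m + int j)) has_sum c j * theta (y j) r) UNIV"
      using has_sum_cmult_right[OF jacobi_triple_product[of r "y j"], of "c j"] assms
      by (simp add: theta_def)
  qed
  with jacobi_triple_product[of p x] assms show ?thesis
    by (simp add: theta_def has_sum_unique)
qed

lemma theta_term_power:
  assumes "q \<noteq> 0"
  shows "theta_term (q ^ a) (q ^ b) n = (-1) powi n * q powi (int a * n + int b * int (tri n))"
proof -
  have "(- (q ^ a)) powi n = (-1) powi n * (q ^ a) powi n"
    by (simp add: power_int_minus_left)
  moreover have "(q ^ b) ^ tri n = q powi (int b * int (tri n))"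
    by (metis of_nat_mult power_int_of_nat power_mult)
  ultimately show ?thesis using assms
    by (simp add: theta_term_def power_int_add power_int_power)
qed

text \<open>For odd \<open>k\<close> the sign of the term at \<open>k * m + j\<close> separates into
  \<open>(-1) ^ j\<close> and \<open>(-1) powi m\<close>. The exponents are compared after doubling,
  which removes the halves from the triangular numbers.\<close>

lemma theta_term_eqI:
  assumes "q \<noteq> 0" "k mod 2 = 1"
    and e: "2 * int a * (k * m + int j) + int b * ((k * m + int j) * (k * m + int j - 1)) =
            2 * int c + 2 * int d * m + int e * (m * (m - 1))"
  shows "theta_term (q ^ a) (q ^ b) (k * m + int j) =
    (-1) ^ j * q ^ c * theta_term (q ^ d) (q ^ e) m"
proof -
  have "int a * (k * m + int j) + int b * int (tri (k * m + int j)) = int c + (int d * m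
    + int e * int (tri m))"
    using e unfolding tri_double [symmetric] by (simp add: algebra_simps)
  moreover have "(-1 :: complex) powi (k * m + int j) = (-1) ^ j * (-1) powi m"
    using assms(2)
      by (auto simp: power_int_minus_left minus_one_power_iff even_iff_mod_2_eq_zero[of k])
  ultimately show ?thesis
    using assms(1) by (simp add: theta_term_power power_int_add)
qed


lemma prod_lessThan_2: "(\<Prod>j<2. f j) = f 0 * f 1" for f :: "nat \<Rightarrow> 'a :: comm_monoid_mult"
  by (simp add: eval_nat_numeral mult_ac)

lemma prod_lessThan_5: "(\<Prod>j<5. f j) = f 0 * f 1 * f 2 * f 3 * f 4"
  for f :: "nat \<Rightarrow> 'a :: comm_monoid_mult"
  by (simp add: eval_nat_numeral mult_ac)

lemma sum_lessThan_5: "(\<Sum>j<5. f j) = f 0 + f 1 + f 2 + f 3 + f 4"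
  for f :: "nat \<Rightarrow> 'a :: comm_monoid_add"
  by (simp add: eval_nat_numeral add_ac)

lemma norm_power_less_1:
  fixes q :: complex
  assumes "0 < norm q" "norm q < 1" "n > 0"
  shows "norm (q ^ n) < 1" "q ^ n \<noteq> 0" "0 < norm (q ^ n)"
  using assms by (auto simp: norm_power power_less_one_iff)

lemma theta_dissection_5:
  assumes "0 < norm q" "norm q < 1" "b > 0" "e > 0"
    and "\<And>j m. 2 * int a * (5 * m + int j) + int b * ((5 * m + int j) * (5 * m + int j - 1)) =
            2 * int (c j) + 2 * int (d j) * m + int e * (m * (m - 1))"
  shows "theta (q ^ a) (q ^ b) = (\<Sum>j<5. (-1) ^ j * q ^ c j * theta (q ^ d j) (q ^ e))"
proof (rule theta_dissection)
  show "theta_term (q ^ a) (q ^ b) (int 5 * m + int j) =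
    (-1) ^ j * q ^ c j * theta_term (q ^ d j) (q ^ e) m" for j m
    using theta_term_eqI[of q 5 a m j b "c j" "d j" e] assms by auto
qed (use norm_power_less_1[OF assms(1,2)] assms in auto)

text \<open>Splitting the factors of the Euler product modulo 3 produces exactly the three products
  of the triple product; this is the pentagonal number theorem in product form.\<close>

lemma euler_eq_theta:
  assumes "norm q < 1" "q \<noteq> 0"
  shows "euler q = theta q (q ^ 3)"
proof -
  have "q ^ 3 / q = q ^ 2" using assms by (simp add: power2_eq_square power3_eq_cube)
  moreover have "euler q = qpoch q (q ^ 3) * qpoch (q ^ 2) (q ^ 3) * qpoch (q ^ 3) (q ^ 3)"
    using qpoch_split[OF assms(1), of 3 q] by (simp add: euler_def eval_nat_numeral mult_ac)
  ultimately show ?thesis by (simp add: theta_def euler_def)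
qed

text \<open>For \<open>x = q\<close> and \<open>p = q ^ 2\<close> the two q-products of the theta
  function coincide, and each is \<open>euler q / euler (q ^ 2)\<close>.\<close>

lemma theta_eq_euler:
  assumes "norm q < 1" "q \<noteq> 0"
  shows "theta q (q ^ 2) * euler (q ^ 2) = euler q ^ 2"
proof -
  have "q ^ 2 / q = q" using assms by (simp add: power2_eq_square)
  moreover have "euler q = qpoch q (q ^ 2) * euler (q ^ 2)"
    using qpoch_split[OF assms(1), of 2 q] by (simp add: euler_def eval_nat_numeral mult_ac)
  ultimately show ?thesis by (simp add: theta_def power2_eq_square)
qed

text \<open>The five pieces start at the pentagonal numbers 0, 1, 5, 12, 22, which are 0, 1, 0, 2, 2
  modulo 5; all else is a function of \<open>q ^ 5\<close>. The piece at 1 is an Euler product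
  again.\<close>

lemma euler_dissection:
  assumes "0 < norm q" "norm q < 1"
  shows "euler q = (theta (q ^ 35) (q ^ 75) + q ^ 5 * theta (q ^ 65) (q ^ 75)) - q * euler (q ^ 25)
     + (q ^ 22 * theta (q ^ 95) (q ^ 75) - q ^ 12 * theta (q ^ 80) (q ^ 75))"
proof -
  have q: "q \<noteq> 0" using assms by auto
  have "euler (q ^ 25) = theta (q ^ 25) (q ^ 75)"
    using euler_eq_theta[of "q ^ 25"] norm_power_less_1[OF assms, of 25] by (simp flip: power_mult)
  also have "\<dots> = theta (q ^ 50) (q ^ 75)"
    using theta_reflect[of "q ^ 50" "q ^ 75"] q by (simp flip: power_diff)
  finally have *: "theta (q ^ 50) (q ^ 75) = euler (q ^ 25)" ..
  define c :: "nat \<Rightarrow> nat" where "c j = nat (int j * (3 * int j - 1) div 2)" for j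
  have c: "2 * int (c j) = int j * (3 * int j - 1)" for j
  proof -
    have "int j * (3 * int j - 1) \<ge> 0" by (cases j) auto
    thus ?thesis unfolding c_def by auto
  qed
  have "theta (q ^ 1) (q ^ 3) = (\<Sum>j<5. (-1) ^ j * q ^ c j * theta (q ^ (35 + 15 * j)) (q ^ 75))"
    by (rule theta_dissection_5[OF assms]) (simp_all add: c, simp add: algebra_simps)
  moreover have "c 0 = 0" "c 1 = 1" "c 2 = 5" "c 3 = 12" "c 4 = 22" by (simp_all add: c_def)
  ultimately show ?thesis
    using euler_eq_theta[OF assms(2) q] by (simp add: * sum_lessThan_5)
qed

text \<open>The five pieces start at the squares 0, 1, 4, 9, 16. Reflection and shift identify the
  piece at 9 with the one at 4 and the piece at 16 with the one at 1, whence the factors 2.\<close>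

lemma theta_square_dissection:
  assumes "0 < norm q" "norm q < 1"
  shows "theta q (q ^ 2) = theta (q ^ 25) (q ^ 50) - 2 * q * theta (q ^ 35) (q ^ 50)
     + 2 * q ^ 4 * theta (q ^ 45) (q ^ 50)"
proof -
  have q: "q \<noteq> 0" using assms by auto
  note n50 = norm_power_less_1(1,2)[OF assms, of 50]
  have 1: "theta (q ^ 55) (q ^ 50) = - theta (q ^ 45) (q ^ 50) / q ^ 5"
    using theta_shift[OF n50, of "q ^ 5"] theta_reflect[of "q ^ 5" "q ^ 50"] q
    by (simp flip: power_add power_diff)
  have 2: "theta (q ^ 65) (q ^ 50) = - theta (q ^ 35) (q ^ 50) / q ^ 15"
    using theta_shift[OF n50, of "q ^ 15"] theta_reflect[of "q ^ 15" "q ^ 50"] q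
    by (simp flip: power_add power_diff)
  have "theta (q ^ 1) (q ^ 2) = (\<Sum>j<5. (-1) ^ j * q ^ (j * j) * theta (q ^ (25 + 10 * j)) (q ^ 50))"
    by (rule theta_dissection_5[OF assms]) (simp_all add: algebra_simps)
  moreover have "q ^ 9 * theta (q ^ 55) (q ^ 50) = - (q ^ 4 * theta (q ^ 45) (q ^ 50))"
    unfolding 1 using q by (simp add: field_simps flip: power_add)
  moreover have "q ^ 16 * theta (q ^ 65) (q ^ 50) = - (q * theta (q ^ 35) (q ^ 50))"
    unfolding 2 using q by (simp add: field_simps flip: power_Suc)
  ultimately show ?thesis by (simp add: sum_lessThan_5)
qed

subsection \<open>Grading by a fifth root of unity\<close>

definition zeta5 :: complex where "zeta5 = cis (2 * pi / 5)"

lemma zeta5_power_5 [simp]: "zeta5 ^ 5 = 1"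
  unfolding zeta5_def Complex.DeMoivre by simp

lemma zeta5_nonzero [simp]: "zeta5 \<noteq> 0" and norm_zeta5 [simp]: "norm zeta5 = 1"
  by (simp_all add: zeta5_def)

lemma zeta5_power_mod: "zeta5 ^ n = zeta5 ^ (n mod 5)"
proof -
  have "zeta5 ^ (5 * (n div 5) + n mod 5) = zeta5 ^ (n mod 5)"
    by (simp only: power_add power_mult zeta5_power_5 power_one mult_1_left)
  thus ?thesis by simp
qed

lemma zeta5_neq_1: "zeta5 \<noteq> 1"
proof
  assume "zeta5 = 1"
  hence "Im (cis (2 * pi / 5)) = 0" by (simp add: zeta5_def)
  hence "sin (2 * pi / 5) = 0" by simp
  moreover have "sin (2 * pi / 5) > 0" by (rule sin_gt_zero) (use pi_gt_zero in auto)
  ultimately show False by simp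
qed

lemma zeta5_power_eq_1_iff: "zeta5 ^ n = 1 \<longleftrightarrow> n mod 5 = 0"
proof
  assume n: "zeta5 ^ n = 1"
  hence m: "zeta5 ^ (n mod 5) = 1" using zeta5_power_mod by simp
  \<comment> \<open>The exponents 2, 3, 4 are prime to 5, so together with
    \<open>zeta5 ^ 5 = 1\<close> each equation forces \<open>zeta5 = 1\<close>.\<close>
  have "zeta5 ^ 2 = 1 \<Longrightarrow> zeta5 = 1" "zeta5 ^ 3 = 1 \<Longrightarrow> zeta5 = 1" "zeta5 ^ 4 = 1 \<Longrightarrow> zeta5 = 1"
    using zeta5_power_5 by algebra+
  hence "zeta5 ^ 1 \<noteq> 1" "zeta5 ^ 2 \<noteq> 1" "zeta5 ^ 3 \<noteq> 1" "zeta5 ^ 4 \<noteq> 1"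
    using zeta5_neq_1 by auto
  moreover have "n mod 5 = 0 \<or> n mod 5 = 1 \<or> n mod 5 = 2 \<or> n mod 5 = 3 \<or> n mod 5 = 4" by presburger
  ultimately show "n mod 5 = 0" using m by metis
qed (simp add: zeta5_power_mod[of n])

lemma sum_powers_eq_0:
  fixes w :: complex
  assumes "w ^ 5 = 1" "w \<noteq> 1"
  shows "(\<Sum>k<5. w ^ k) = 0"
  using geometric_sum[OF assms(2), of 5] assms by simp

text \<open>Inversion of the discrete Fourier transform of length 5, by orthogonality of the powers
  of \<open>zeta5\<close>.\<close>

lemma fourier_5_zero:
  fixes F :: "nat \<Rightarrow> complex"
  assumes "\<And>k. k < 5 \<Longrightarrow> (\<Sum>j<5. zeta5 ^ (j * k) * F j) = 0" "i < 5"
  shows "F i = 0"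
proof -
  \<comment> \<open>The weight is \<open>zeta5\<close> to the power \<open>- i * k\<close>, with
    \<open>5 - i\<close> in place of \<open>- i\<close> to stay in the naturals.\<close>
  have "0 = (\<Sum>k<5. zeta5 ^ ((5 - i) * k) * (\<Sum>j<5. zeta5 ^ (j * k) * F j))"
    using assms(1) by simp
  also have "\<dots> = (\<Sum>k<5. \<Sum>j<5. F j * (zeta5 ^ (5 - i + j)) ^ k)"
    unfolding sum_distrib_left
  proof (intro sum.cong refl)
    fix k j
    show "zeta5 ^ ((5 - i) * k) * (zeta5 ^ (j * k) * F j) = F j * (zeta5 ^ (5 - i + j)) ^ k"
      by (simp only: power_add power_mult [symmetric] power_mult_distrib mult_ac)
  qed
  also have "\<dots> = (\<Sum>j<5. F j * (\<Sum>k<5. (zeta5 ^ (5 - i + j)) ^ k))"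
    by (subst sum.swap) (simp only: sum_distrib_left)
  also have "\<dots> = (\<Sum>j<5. if j = i then 5 * F i else 0)"
  proof (intro sum.cong refl)
    fix j :: nat assume j: "j \<in> {..<5}"
    show "F j * (\<Sum>k<5. (zeta5 ^ (5 - i + j)) ^ k) = (if j = i then 5 * F i else 0)"
    proof (cases "j = i")
      case True
      thus ?thesis using assms(2) by simp
    next
      case False
      have "(5 - i + j) mod 5 \<noteq> 0"
      proof
        assume "(5 - i + j) mod 5 = 0"
        then obtain m where "5 - i + j = 5 * m" by (auto elim: dvdE simp: mod_eq_0_iff_dvd)
        moreover from this have "m = 1" using j assms(2) by auto
        ultimately show False using False assms(2) by simp
      qed
      hence "zeta5 ^ (5 - i + j) \<noteq> 1" by (simp add: zeta5_power_eq_1_iff)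
      moreover have "(zeta5 ^ (5 - i + j)) ^ 5 = 1"
        by (metis mult.commute power_mult power_one zeta5_power_5)
      ultimately show ?thesis using False sum_powers_eq_0 by simp
    qed
  qed
  also have "\<dots> = 5 * F i" using assms(2) by simp
  finally show ?thesis by simp
qed

text \<open>Evaluating the vanishing sum at the five points \<open>zeta5 ^ k * q\<close>, which all
  have the norm of \<open>q\<close>, makes the Fourier transform of the components zero.\<close>

lemma graded_zero:
  fixes F :: "nat \<Rightarrow> complex \<Rightarrow> complex"
  assumes grade: "\<And>j q. j < 5 \<Longrightarrow> F j (zeta5 * q) = zeta5 ^ j * F j q"
    and zero: "\<And>q. 0 < norm q \<Longrightarrow> norm q < 1 \<Longrightarrow> (\<Sum>j<5. F j q) = 0"
    and "0 < norm q" "norm q < 1" "i < 5"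
  shows "F i q = 0"
proof (rule fourier_5_zero[OF _ \<open>i < 5\<close>, of "\<lambda>j. F j q"])
  fix k :: nat
  have *: "F j (zeta5 ^ k * q) = zeta5 ^ (j * k) * F j q" if "j < 5" for j
    using that by (induction k) (simp_all add: grade mult.assoc power_add)
  have "(\<Sum>j<5. F j (zeta5 ^ k * q)) = 0"
    by (rule zero) (use assms in \<open>simp_all add: norm_mult norm_power\<close>)
  thus "(\<Sum>j<5. zeta5 ^ (j * k) * F j q) = 0" by (simp add: *)
qed

section \<open>Graded components of the Euler product and of the theta series of squares\<close>

definition euler_part0 :: "complex \<Rightarrow> complex" where
  "euler_part0 q = theta (q ^ 35) (q ^ 75) + q ^ 5 * theta (q ^ 65) (q ^ 75)"

definition euler_part2 :: "complex \<Rightarrow> complex" where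
  "euler_part2 q = q ^ 22 * theta (q ^ 95) (q ^ 75) - q ^ 12 * theta (q ^ 80) (q ^ 75)"

text \<open>Minus the quotient of component 1 of \<open>euler\<close> by its component 0.\<close>

definition rr_cf :: "complex \<Rightarrow> complex" where
  "rr_cf q = q * euler (q ^ 25) / euler_part0 q"

definition theta_part1 :: "complex \<Rightarrow> complex" where
  "theta_part1 q = - 2 * q * theta (q ^ 35) (q ^ 50)"

definition theta_part4 :: "complex \<Rightarrow> complex" where
  "theta_part4 q = 2 * q ^ 4 * theta (q ^ 45) (q ^ 50)"

lemma zeta5_invariant:
  assumes "n mod 5 = 0"
  shows "(zeta5 * q) ^ n = q ^ n"
  using assms by (simp add: power_mult_distrib zeta5_power_mod[of n])

lemma euler_part0_grade: "euler_part0 (zeta5 * q) = euler_part0 q"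
  by (simp add: euler_part0_def zeta5_invariant)

lemma euler_part2_grade: "euler_part2 (zeta5 * q) = zeta5 ^ 2 * euler_part2 q"
proof -
  have "(zeta5 * q) ^ 22 = zeta5 ^ 2 * q ^ 22" "(zeta5 * q) ^ 12 = zeta5 ^ 2 * q ^ 12"
    by (simp_all add: power_mult_distrib zeta5_power_mod[of 22] zeta5_power_mod[of 12])
  moreover have "(zeta5 * q) ^ 95 = q ^ 95" "(zeta5 * q) ^ 80 = q ^ 80" "(zeta5 * q) ^ 75 = q ^ 75"
    by (simp_all add: zeta5_invariant)
  ultimately show ?thesis
    unfolding euler_part2_def by (simp only: mult.assoc right_diff_distrib)
qed

lemma theta_part1_grade: "theta_part1 (zeta5 * q) = zeta5 * theta_part1 q"
  by (simp add: theta_part1_def zeta5_invariant)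

lemma theta_part4_grade: "theta_part4 (zeta5 * q) = zeta5 ^ 4 * theta_part4 q"
  by (simp add: theta_part4_def zeta5_invariant power_mult_distrib[of _ _ 4])

lemma rr_cf_grade: "rr_cf (zeta5 * q) = zeta5 * rr_cf q"
  by (simp add: rr_cf_def zeta5_invariant euler_part0_grade)

lemma zeta5_mult_square: "(zeta5 * q) ^ 2 = zeta5 * (zeta5 * q ^ 2)"
  by (simp add: power2_eq_square)

lemma euler_part0_sq_grade: "euler_part0 ((zeta5 * q) ^ 2) = euler_part0 (q ^ 2)"
  by (simp only: zeta5_mult_square euler_part0_grade)

text \<open>The twist of \<open>q\<close> by \<open>zeta5\<close> twists \<open>q ^ 2\<close> twice,
  so grade 2 in \<open>q ^ 2\<close> becomes grade 4 in \<open>q\<close>.\<close>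

lemma euler_part2_sq_grade: "euler_part2 ((zeta5 * q) ^ 2) = zeta5 ^ 4 * euler_part2 (q ^ 2)"
  by (simp only: zeta5_mult_square euler_part2_grade) (simp flip: mult.assoc power_add)

lemma euler_grading:
  "0 < norm q \<Longrightarrow> norm q < 1 \<Longrightarrow> euler q = euler_part0 q - q * euler (q ^ 25) + euler_part2 q"
  unfolding euler_part0_def euler_part2_def by (rule euler_dissection)

lemma theta_grading:
  "0 < norm q \<Longrightarrow> norm q < 1 \<Longrightarrow> theta q (q ^ 2) = theta (q ^ 25) (q ^ 50) + theta_part1 q
    + theta_part4 q"
  using theta_square_dissection[of q] by (simp add: theta_part1_def theta_part4_def)

text \<open>Both sides of \<open>euler q ^ 2 = theta q (q ^ 2) * euler (q ^ 2)\<close> are expanded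
  into components; the five conclusions are the grades 0 to 4, grades of products being added modulo
  5.\<close>

lemma graded_components:
  assumes "0 < norm q" "norm q < 1"
  shows "euler_part0 q ^ 2 = theta (q ^ 25) (q ^ 50) * euler_part0 (q ^ 2)
    + theta_part1 q * euler_part2 (q ^ 2)"
    and "- 2 * q * euler (q ^ 25) * euler_part0 q = theta_part1 q * euler_part0 (q ^ 2)
      - theta_part4 q * q ^ 2 * euler (q ^ 50)"
    and "q ^ 2 * euler (q ^ 25) ^ 2 + 2 * euler_part0 q * euler_part2 q =
      - (theta (q ^ 25) (q ^ 50) * q ^ 2 * euler (q ^ 50))"
    and "- 2 * q * euler (q ^ 25) * euler_part2 q = theta_part4 q * euler_part2 (q ^ 2)
      - theta_part1 q * q ^ 2 * euler (q ^ 50)"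
    and "euler_part2 q ^ 2 = theta (q ^ 25) (q ^ 50) * euler_part2 (q ^ 2)
      + theta_part4 q * euler_part0 (q ^ 2)"
proof -
  \<comment> \<open>The position in the list is the grade.\<close>
  define F where "F j q =
     [euler_part0 q ^ 2 - theta (q ^ 25) (q ^ 50) * euler_part0 (q ^ 2)
       - theta_part1 q * euler_part2 (q ^ 2),
      - 2 * q * euler (q ^ 25) * euler_part0 q - theta_part1 q * euler_part0 (q ^ 2)
        + theta_part4 q * q ^ 2 * euler (q ^ 50),
      q ^ 2 * euler (q ^ 25) ^ 2 + 2 * euler_part0 q * euler_part2 q
        + theta (q ^ 25) (q ^ 50) * q ^ 2 * euler (q ^ 50),
      - 2 * q * euler (q ^ 25) * euler_part2 q - theta_part4 q * euler_part2 (q ^ 2)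
        + theta_part1 q * q ^ 2 * euler (q ^ 50),
      euler_part2 q ^ 2 - theta (q ^ 25) (q ^ 50) * euler_part2 (q ^ 2)
        - theta_part4 q * euler_part0 (q ^ 2)] ! j" for j q
  have F: "F i q = 0" if "i < 5" for i
  proof (rule graded_zero[OF _ _ assms that])
    fix j :: nat and q assume "j < 5"
    define z where "z = zeta5"
    have z: "z ^ 5 = 1" by (simp add: z_def)
    have inv: "(z * q) ^ 25 = q ^ 25" "(z * q) ^ 50 = q ^ 50"
      by (simp_all add: z_def zeta5_invariant)
    note gr = euler_part0_grade euler_part2_grade theta_part1_grade theta_part4_grade
      euler_part0_sq_grade euler_part2_sq_grade
    have "F 0 (z * q) = z ^ 0 * F 0 q"
      unfolding F_def inv nth_Cons_0 gr[folded z_def] using z by algebra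
    moreover have "F 1 (z * q) = z * F 1 q"
      unfolding F_def inv One_nat_def nth_Cons_Suc nth_Cons_0 gr[folded z_def] using z by algebra
    moreover have "F 2 (z * q) = z ^ 2 * F 2 q"
      unfolding F_def inv numeral_2_eq_2 nth_Cons_Suc nth_Cons_0 gr[folded z_def, unfolded numeral_2_eq_2]
      using z by (simp add: power_mult_distrib algebra_simps)
    moreover have "F 3 (z * q) = z ^ 3 * F 3 q"
      unfolding F_def inv by (simp add: gr[folded z_def]) (use z in algebra)
    moreover have "F 4 (z * q) = z ^ 4 * F 4 q"
      unfolding F_def inv
        by (simp add: gr[folded z_def]) (simp add: power_mult_distrib algebra_simps flip: power_mult)
    moreover have "j = 0 \<or> j = 1 \<or> j = 2 \<or> j = 3 \<or> j = 4" using \<open>j < 5\<close> by auto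
    ultimately show "F j (zeta5 * q) = zeta5 ^ j * F j q"
      unfolding z_def by auto
  next
    fix q :: complex assume q: "0 < norm q" "norm q < 1"
    note q2 = norm_power_less_1[OF q, of 2]
    have e2: "euler (q ^ 2) = euler_part0 (q ^ 2) - q ^ 2 * euler (q ^ 50) + euler_part2 (q ^ 2)"
      using euler_grading[OF q2(3) q2(1)] by (simp flip: power_mult)
    have "(euler_part0 q - q * euler (q ^ 25) + euler_part2 q) ^ 2 =
          (theta (q ^ 25) (q ^ 50) + theta_part1 q + theta_part4 q) * (euler_part0 (q ^ 2)
            - q ^ 2 * euler (q ^ 50) + euler_part2 (q ^ 2))"
      using theta_eq_euler[of q] q
        unfolding e2 [symmetric] euler_grading[OF q, symmetric] theta_grading[OF q, symmetric]
      by auto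
    thus "(\<Sum>j<5. F j q) = 0"
      unfolding F_def sum_lessThan_5 by (simp add: algebra_simps power2_eq_square)
  qed
  show "euler_part0 q ^ 2 = theta (q ^ 25) (q ^ 50) * euler_part0 (q ^ 2)
    + theta_part1 q * euler_part2 (q ^ 2)"
    and "- 2 * q * euler (q ^ 25) * euler_part0 q = theta_part1 q * euler_part0 (q ^ 2)
      - theta_part4 q * q ^ 2 * euler (q ^ 50)"
    and "q ^ 2 * euler (q ^ 25) ^ 2 + 2 * euler_part0 q * euler_part2 q =
      - (theta (q ^ 25) (q ^ 50) * q ^ 2 * euler (q ^ 50))"
    and "- 2 * q * euler (q ^ 25) * euler_part2 q = theta_part4 q * euler_part2 (q ^ 2)
      - theta_part1 q * q ^ 2 * euler (q ^ 50)"
    and "euler_part2 q ^ 2 = theta (q ^ 25) (q ^ 50) * euler_part2 (q ^ 2)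
      + theta_part4 q * euler_part0 (q ^ 2)"
    using F[of 0] F[of 1] F[of 2] F[of 3] F[of 4] unfolding F_def
    by (simp_all add: algebra_simps eq_neg_iff_add_eq_0)
qed

section \<open>The relation between \<open>rr_cf q\<close> and \<open>rr_cf (q ^ 2)\<close>\<close>

lemma theta_25_50:
  assumes "0 < norm q" "norm q < 1"
  shows "theta (q ^ 25) (q ^ 50) * euler (q ^ 50) = euler (q ^ 25) ^ 2"
  using theta_eq_euler[of "q ^ 25"] norm_power_less_1[OF assms, of 25] by (simp flip: power_mult)

text \<open>In grade 2 the right-hand side reduces to \<open>- (q ^ 2 * euler (q ^ 25) ^ 2)\<close>
  by \<open>theta_25_50\<close>. Hence component 0 never vanishes, and component 2 is determined by
  \<open>rr_cf\<close>.\<close>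

lemma euler_part0_euler_part2:
  assumes "0 < norm q" "norm q < 1"
  shows "euler_part0 q * euler_part2 q = - (q ^ 2 * euler (q ^ 25) ^ 2)"
  using graded_components(3)[OF assms] theta_25_50[OF assms] by algebra

lemma euler_part0_nonzero:
  assumes "0 < norm q" "norm q < 1"
  shows "euler_part0 q \<noteq> 0"
  using euler_part0_euler_part2[OF assms] assms euler_power_nonzero[of q 25] by auto

lemma rr_cf_nonzero:
  assumes "0 < norm q" "norm q < 1"
  shows "rr_cf q \<noteq> 0"
  using euler_part0_nonzero[OF assms] assms euler_power_nonzero[of q 25] by (auto simp: rr_cf_def)

lemma euler_part0_eq_rr_cf:
  assumes "0 < norm q" "norm q < 1"
  shows "euler_part0 q = q * euler (q ^ 25) / rr_cf q"
  using euler_part0_nonzero[OF assms] assms euler_power_nonzero[of q 25] by (auto simp: rr_cf_def)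

lemma euler_part2_eq_rr_cf:
  assumes "0 < norm q" "norm q < 1"
  shows "euler_part2 q = - (q * euler (q ^ 25) * rr_cf q)"
proof -
  have "euler_part0 q * euler_part2 q = euler_part0 q * - (q * euler (q ^ 25) * rr_cf q)"
    unfolding euler_part0_euler_part2[OF assms] using euler_part0_nonzero[OF assms]
      by (simp add: rr_cf_def power2_eq_square)
  thus ?thesis using euler_part0_nonzero[OF assms] by (simp only: mult_cancel_left) simp
qed

lemma euler_eq_rr_cf:
  assumes "0 < norm q" "norm q < 1"
  shows "euler q = q * euler (q ^ 25) * (1 / rr_cf q - 1 - rr_cf q)"
  using euler_grading[OF assms]
    by (simp add: euler_part0_eq_rr_cf[OF assms] euler_part2_eq_rr_cf[OF assms] algebra_simps)

text \<open>Here \<open>g\<close> and \<open>h\<close> are the theta components of grades 1 and 4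
  divided by the one of grade 0. Grade 0 gives \<open>g\<close>, grade 4 gives \<open>h\<close>, and
  grades 1 and 3 supply the relation between \<open>u\<close> and \<open>v\<close>.\<close>

lemma theta_part_relations:
  fixes q :: complex
  assumes "0 < norm q" "norm q < 1"
  defines "u \<equiv> rr_cf q" and "v \<equiv> rr_cf (q ^ 2)"
  defines "g \<equiv> theta_part1 q * euler (q ^ 50) / euler (q ^ 25) ^ 2"
  defines "h \<equiv> theta_part4 q * euler (q ^ 50) / euler (q ^ 25) ^ 2"
  shows "v - u ^ 2 = u * v ^ 2 * (v + u ^ 2)"
    and "g = 1 / v ^ 2 - 1 / (u ^ 2 * v)" and "h = u ^ 2 * v + v ^ 2"
proof -
  have q2: "0 < norm (q ^ 2)" "norm (q ^ 2) < 1"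
    using norm_power_less_1[OF assms(1,2), of 2] by simp_all
  have nz: "q \<noteq> 0" "euler (q ^ 25) \<noteq> 0" "euler (q ^ 50) \<noteq> 0" "u \<noteq> 0" "v \<noteq> 0"
    using assms(1,2) euler_power_nonzero[of q 25] euler_power_nonzero[of q 50] rr_cf_nonzero[OF assms(1,2)]
      rr_cf_nonzero[OF q2] by (auto simp: u_def v_def)
  define e where "e = euler (q ^ 25)"
  define f where "f = euler (q ^ 50)"
  have ef: "e \<noteq> 0" "f \<noteq> 0" using nz by (auto simp: e_def f_def)
  have G: "theta_part1 q = g * e ^ 2 / f" "theta_part4 q = h * e ^ 2 / f" "theta (q ^ 25) (q ^ 50)
    = e ^ 2 / f"
    using nz theta_25_50[OF assms(1,2)] by (simp_all add: g_def h_def e_def f_def field_simps)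
  have E: "euler_part0 q = q * e / u" "euler_part2 q = - (q * e * u)" "euler_part0 (q ^ 2) =
    q ^ 2 * f / v" "euler_part2 (q ^ 2) = - (q ^ 2 * f * v)"
    using euler_part0_eq_rr_cf[OF assms(1,2)] euler_part2_eq_rr_cf[OF assms(1,2)] euler_part0_eq_rr_cf[OF q2] euler_part2_eq_rr_cf[OF q2]
    by (simp_all add: u_def v_def e_def f_def flip: power_mult)
  note comp = graded_components[OF assms(1,2), folded e_def f_def, unfolded G E]
  have 1: "v = u ^ 2 - g * v ^ 2 * u ^ 2"
    using comp(1) nz ef by (simp add: divide_simps power2_eq_square split: if_splits) algebra
  have 2: "- 2 * v = g * u - h * u * v"
    using comp(2) nz ef by (simp add: divide_simps power2_eq_square split: if_splits) algebra
  have 3: "2 * u = - g - v * h"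
    using comp(4) nz ef by (simp add: divide_simps power2_eq_square split: if_splits) algebra
  have 4: "u ^ 2 * v = h - v ^ 2"
    using comp(5) nz ef by (simp add: divide_simps power2_eq_square split: if_splits) algebra
  show h: "h = u ^ 2 * v + v ^ 2" using 4 by simp
  show g: "g = 1 / v ^ 2 - 1 / (u ^ 2 * v)"
    using 1 nz by (simp add: field_simps power2_eq_square)
  define d where "d = v - u ^ 2 - u * v ^ 2 * (v + u ^ 2)"
  \<comment> \<open>Grades 1 and 3 are linear in \<open>g\<close> and \<open>v * h\<close> and give
    \<open>u * g = - (v + u ^ 2)\<close>; substituting this into grade 0 yields the
    relation.\<close>
  have "u * (2 * d) = 0"
    unfolding d_def using 1 2 3 h nz by algebra
  hence "d = 0" using nz by simp
  thus "v - u ^ 2 = u * v ^ 2 * (v + u ^ 2)" by (simp add: d_def)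
qed

text \<open>The odd multiples of 5 fall into the classes 5, 15, 25, 35, 45 modulo 50. The two theta
  functions use 15, 35 and 5, 45, while class 25 is
  \<open>euler (q ^ 25) / euler (q ^ 50)\<close>.\<close>

lemma theta_product:
  assumes "0 < norm q" "norm q < 1"
  shows "theta (q ^ 35) (q ^ 50) * theta (q ^ 45) (q ^ 50) * euler (q ^ 25) * euler (q ^ 10)
     = euler (q ^ 5) * euler (q ^ 50) ^ 3"
proof -
  have q: "q \<noteq> 0" using assms by auto
  have split2: "euler (q ^ n) = qpoch (q ^ n) (q ^ (2 * n)) * euler (q ^ (2 * n))" if "n > 0" for n
    using qpoch_split[of "q ^ n" 2 "q ^ n"] norm_power_less_1[OF assms that]
    by (simp add: euler_def prod_lessThan_2 mult_ac flip: power_mult power_add mult_2_right)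
  have "qpoch (q ^ 5) (q ^ 10) = qpoch (q ^ 5) (q ^ 50) * qpoch (q ^ 15) (q ^ 50) *
     qpoch (q ^ 25) (q ^ 50) * qpoch (q ^ 35) (q ^ 50) * qpoch (q ^ 45) (q ^ 50)"
    using qpoch_split[of "q ^ 10" 5 "q ^ 5"] norm_power_less_1[OF assms, of 10]
    by (simp add: prod_lessThan_5 flip: power_mult power_add)
  moreover have "theta (q ^ 35) (q ^ 50) =
    qpoch (q ^ 35) (q ^ 50) * qpoch (q ^ 15) (q ^ 50) * euler (q ^ 50)"
    "theta (q ^ 45) (q ^ 50) = qpoch (q ^ 45) (q ^ 50) * qpoch (q ^ 5) (q ^ 50) * euler (q ^ 50)"
    unfolding theta_def using q by (simp_all flip: power_diff)
  ultimately show ?thesis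
    using split2[of 5] split2[of 25] by (simp add: power3_eq_cube)
qed

definition eta_z :: "complex \<Rightarrow> complex" where
  "eta_z q = q * euler (q ^ 10) ^ 5 * euler q / (euler (q ^ 2) * euler (q ^ 5) ^ 5)"

text \<open>The left side is the product \<open>g * h\<close> of the normalised theta components, an
  eta quotient by \<open>theta_product\<close>.\<close>

lemma eta_z_eq_rr_cf:
  assumes "0 < norm q" "norm q < 1"
  defines "u \<equiv> rr_cf q" and "v \<equiv> rr_cf (q ^ 2)"
  shows "(1 / v ^ 2 - 1 / (u ^ 2 * v)) * (u ^ 2 * v + v ^ 2) = - 4 * eta_z (q ^ 5)"
proof -
  have nz: "euler (q ^ 25) \<noteq> 0" "euler (q ^ 10) \<noteq> 0" using assms(1,2) euler_power_nonzero by auto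
  define e where "e = euler (q ^ 25)"
  define f where "f = euler (q ^ 50)"
  define t where "t = theta (q ^ 35) (q ^ 50) * theta (q ^ 45) (q ^ 50)"
  have nz: "e \<noteq> 0" "euler (q ^ 10) \<noteq> 0"
    using assms(1,2) euler_power_nonzero by (auto simp: e_def)
  have "(1 / v ^ 2 - 1 / (u ^ 2 * v)) * (u ^ 2 * v + v ^ 2) =
    (theta_part1 q * f / e ^ 2) * (theta_part4 q * f / e ^ 2)"
    unfolding u_def v_def e_def f_def theta_part_relations(2,3)[OF assms(1,2), symmetric] ..
  also have "\<dots> = - 4 * (q * q ^ 4) * t * f ^ 2 / (e ^ 2 * e ^ 2)"
    unfolding theta_part1_def theta_part4_def t_def by (simp add: power2_eq_square)
  also have "t = euler (q ^ 5) * f ^ 3 / (e * euler (q ^ 10))"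
    using theta_product[OF assms(1,2)] nz by (simp add: field_simps e_def f_def t_def)
  also have "- 4 * (q * q ^ 4) * (euler (q ^ 5) * f ^ 3 / (e * euler (q ^ 10))) * f ^ 2 / (e ^ 2 * e ^ 2) =
      - 4 * (q ^ 5 * (f ^ 5 * euler (q ^ 5)) / (euler (q ^ 10) * e ^ 5))"
    by (simp add: mult_ac flip: power_add power_Suc power_Suc2)
  finally show ?thesis
    by (simp add: eta_z_def e_def f_def mult_ac flip: power_mult)
qed

subsection \<open>Products over the fifth roots of unity\<close>

lemma prod_root_of_unity:
  fixes w t :: complex
  assumes "w ^ 5 = 1" "w \<noteq> 1"
  shows "(\<Prod>j<5. 1 - w ^ j * t) = 1 - t ^ 5"
proof -
  have "1 + w + w ^ 2 + w ^ 3 + w ^ 4 = 0"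
    using sum_powers_eq_0[OF assms] by (simp add: sum_lessThan_5)
  hence "(1 - t) * (1 - w * t) * (1 - w ^ 2 * t) * (1 - w ^ 3 * t) * (1 - w ^ 4 * t) = 1 - t ^ 5"
    by algebra
  thus ?thesis by (simp add: prod_lessThan_5)
qed

lemma qpoch_prod_root_of_unity:
  fixes w a p :: complex
  assumes "w ^ 5 = 1" "w \<noteq> 1" "norm p < 1"
  shows "(\<Prod>j<5. qpoch (w ^ j * a) p) = qpoch (a ^ 5) (p ^ 5)"
proof -
  have "(\<lambda>N. \<Prod>j<5. \<Prod>n<N. 1 - w ^ j * a * p ^ n) \<longlonglongrightarrow> (\<Prod>j<5. qpoch (w ^ j * a) p)"
    by (intro tendsto_prod qpoch_LIMSEQ assms)
  moreover have "(\<Prod>j<5. \<Prod>n<N. 1 - w ^ j * a * p ^ n) = (\<Prod>n<N. 1 - a ^ 5 * (p ^ 5) ^ n)" for N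
  proof -
    have "(\<Prod>j<5. \<Prod>n<N. 1 - w ^ j * a * p ^ n) = (\<Prod>n<N. \<Prod>j<5. 1 - w ^ j * (a * p ^ n))"
      by (subst prod.swap) (simp only: mult.assoc)
    also have "\<dots> = (\<Prod>n<N. 1 - a ^ 5 * (p ^ 5) ^ n)"
      unfolding prod_root_of_unity[OF assms(1,2)]
      by (simp only: power_mult_distrib power_mult [symmetric] mult.commute[of 5])
    finally show ?thesis .
  qed
  moreover have "norm (p ^ 5) < 1" using assms by (simp add: norm_power power_less_one_iff)
  ultimately show ?thesis
    using qpoch_LIMSEQ[of "p ^ 5" "a ^ 5"] LIMSEQ_unique by fastforce
qed

text \<open>Split each twisted product modulo 5. In a class prime to 5 the twists run through all
  fifth roots of unity and fuse into one product with base \<open>q ^ 25\<close>; the remaining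
  class yields \<open>euler (q ^ 5) ^ 5\<close>. The factor \<open>euler (q ^ 25)\<close> fills the
  gap in the fused products, giving the sixth power.\<close>

lemma euler_norm:
  assumes "0 < norm q" "norm q < 1"
  shows "(\<Prod>j<5. euler (zeta5 ^ j * q)) * euler (q ^ 25) = euler (q ^ 5) ^ 6"
proof -
  have q: "norm (zeta5 ^ j * q) < 1" for j using assms by (simp add: norm_mult norm_power)
  have q5: "norm (q ^ 5) < 1" using norm_power_less_1[OF assms, of 5] by simp
  have split: "euler (zeta5 ^ j * q) = (\<Prod>r<5. qpoch ((zeta5 ^ Suc r) ^ j * q ^ Suc r) (q ^ 5))"
    for j
  proof -
    have "(zeta5 ^ j * q) ^ 5 = q ^ 5"
      using zeta5_power_mod[of "j * 5"] by (simp add: power_mult_distrib flip: power_mult)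
    moreover have "(zeta5 ^ j * q) * (zeta5 ^ j * q) ^ r = (zeta5 ^ Suc r) ^ j * q ^ Suc r" for r
    proof -
      have "(zeta5 ^ j * q) * (zeta5 ^ j * q) ^ r = (zeta5 ^ j * q) ^ Suc r" by simp
      also have "\<dots> = (zeta5 ^ Suc r) ^ j * q ^ Suc r"
        by (simp only: power_mult_distrib power_mult [symmetric] mult.commute)
      finally show ?thesis .
    qed
    ultimately show ?thesis
      using qpoch_split[of "zeta5 ^ j * q" 5 "zeta5 ^ j * q"] q[of j]
      by (simp only: euler_def zero_less_numeral)
  qed
  have "(\<Prod>j<5. euler (zeta5 ^ j * q)) =
    (\<Prod>r<5. \<Prod>j<5. qpoch ((zeta5 ^ Suc r) ^ j * q ^ Suc r) (q ^ 5))"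
    unfolding split by (rule prod.swap)
  also have "\<dots> = (\<Prod>r<5. if r = 4 then euler (q ^ 5) ^ 5 else qpoch ((q ^ 5) ^ Suc r) (q ^ 25))"
  proof (intro prod.cong refl)
    fix r :: nat assume "r \<in> {..<5}"
    show "(\<Prod>j<5. qpoch ((zeta5 ^ Suc r) ^ j * q ^ Suc r) (q ^ 5)) =
        (if r = 4 then euler (q ^ 5) ^ 5 else qpoch ((q ^ 5) ^ Suc r) (q ^ 25))"
    proof (cases "r = 4")
      \<comment> \<open>Here \<open>zeta5 ^ Suc r\<close> is 1, so the five factors
        coincide.\<close>
      case True
      thus ?thesis by (simp add: euler_def del: power_Suc)
    next
      case False
      have "(zeta5 ^ Suc r) ^ 5 = 1"
        by (metis mult.commute power_mult power_one zeta5_power_5)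
      moreover have "zeta5 ^ Suc r \<noteq> 1"
        using False \<open>r \<in> {..<5}\<close> unfolding zeta5_power_eq_1_iff by auto
      moreover have "(q ^ 5) ^ 5 = q ^ 25" "(q ^ Suc r) ^ 5 = (q ^ 5) ^ Suc r"
        by (simp_all only: power_mult [symmetric] mult.commute) simp
      ultimately show ?thesis
        using False qpoch_prod_root_of_unity[OF _ _ q5, of "zeta5 ^ Suc r" "q ^ Suc r"]
        by (simp del: power_Suc)
    qed
  qed
  also have "\<dots> * euler (q ^ 25) = euler (q ^ 5) ^ 5 * (\<Prod>r<5. qpoch ((q ^ 5) ^ Suc r) (q ^ 25))"
    by (simp add: prod_lessThan_5 euler_def del: power_Suc flip: power_mult)
  also have "(\<Prod>r<5. qpoch ((q ^ 5) ^ Suc r) (q ^ 25)) = euler (q ^ 5)"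
    using qpoch_split[OF q5, of 5 "q ^ 5"] by (simp add: euler_def flip: power_mult)
  finally show ?thesis by (simp flip: power_Suc2)
qed

lemma rr_cf_zeta5: "rr_cf (zeta5 ^ j * q) = zeta5 ^ j * rr_cf q"
  by (induction j) (simp_all add: rr_cf_grade mult.assoc)

text \<open>With the golden ratio \<open>a\<close>, the quadratic \<open>1 - w - w ^ 2\<close>
  factors as \<open>(1 - a * w) * (1 - (1 - a) * w)\<close>. The 11 is the Lucas number
  \<open>a ^ 5 + (1 - a) ^ 5\<close>.\<close>

lemma prod_golden:
  fixes u :: complex
  assumes "u \<noteq> 0"
  shows "(\<Prod>j<5. 1 / (zeta5 ^ j * u) - 1 - zeta5 ^ j * u) = 1 / u ^ 5 - 11 - u ^ 5"
proof -
  define a where "a = (1 + complex_of_real (sqrt 5)) / 2"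
  have "complex_of_real (sqrt 5) ^ 2 = 5" by (simp flip: of_real_power)
  hence a: "a ^ 2 = a + 1" by (simp add: a_def power2_eq_square field_simps)
  have f: "1 / (zeta5 ^ j * u) - 1 - zeta5 ^ j * u =
      (1 - zeta5 ^ j * (a * u)) * (1 - zeta5 ^ j * ((1 - a) * u)) / (zeta5 ^ j * u)" for j
  proof -
    define w where "w = zeta5 ^ j * u"
    have "w \<noteq> 0" using assms by (simp add: w_def)
    have "(1 - a * w) * (1 - (1 - a) * w) = 1 - w - w ^ 2" using a by algebra
    hence "1 / w - 1 - w = (1 - a * w) * (1 - (1 - a) * w) / w"
      using \<open>w \<noteq> 0\<close> by (simp add: field_simps power2_eq_square)
    thus ?thesis by (simp add: w_def mult_ac)
  qed
  have "zeta5 * zeta5 ^ 2 * zeta5 ^ 3 * zeta5 ^ 4 = 1"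
    using zeta5_power_mod[of 10] by (simp flip: power_add power_Suc)
  hence den: "(\<Prod>j<5. zeta5 ^ j * u) = u ^ 5"
    by (simp add: prod_lessThan_5) (simp add: eval_nat_numeral mult_ac)
  have "(1 - (a * u) ^ 5) * (1 - ((1 - a) * u) ^ 5) = 1 - 11 * u ^ 5 - u ^ 10"
    using a by algebra
  moreover have "(\<Prod>j<5. 1 / (zeta5 ^ j * u) - 1 - zeta5 ^ j * u) =
      (1 - (a * u) ^ 5) * (1 - ((1 - a) * u) ^ 5) / u ^ 5"
    unfolding f prod_dividef den prod.distrib[of "\<lambda>j. 1 - zeta5 ^ j * (a * u)"]
    by (simp only: prod_root_of_unity[OF zeta5_power_5 zeta5_neq_1])
  ultimately show ?thesis using assms
    by (simp add: divide_simps flip: power_add)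
qed

lemma euler_norm_rr_cf:
  assumes "0 < norm q" "norm q < 1"
  shows "euler (q ^ 5) ^ 6 = q ^ 5 * euler (q ^ 25) ^ 6 * (1 / rr_cf q ^ 5 - 11 - rr_cf q ^ 5)"
proof -
  have "euler (zeta5 ^ j * q) = (zeta5 ^ j * q) * euler (q ^ 25) * (1 / (zeta5 ^ j * rr_cf q) - 1
    - zeta5 ^ j * rr_cf q)" for j
  proof -
    have "(zeta5 ^ j * q) ^ 25 = q ^ 25"
      using zeta5_power_mod[of "j * 25"] by (simp add: power_mult_distrib flip: power_mult)
    thus ?thesis
      using euler_eq_rr_cf[of "zeta5 ^ j * q"] assms by (simp add: rr_cf_zeta5 norm_mult norm_power)
  qed
  hence "(\<Prod>j<5. euler (zeta5 ^ j * q)) =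
      (\<Prod>j<5. zeta5 ^ j * q) * euler (q ^ 25) ^ 5 * (1 / rr_cf q ^ 5 - 11 - rr_cf q ^ 5)"
    by (simp add: prod.distrib prod_golden[OF rr_cf_nonzero[OF assms]])
  moreover have "zeta5 * zeta5 ^ 2 * zeta5 ^ 3 * zeta5 ^ 4 = 1"
    using zeta5_power_mod[of 10] by (simp flip: power_add power_Suc)
  hence "(\<Prod>j<5. zeta5 ^ j * q) = q ^ 5"
    by (simp add: prod_lessThan_5) (simp add: eval_nat_numeral mult_ac)
  ultimately have "euler (q ^ 5) ^ 6 = q ^ 5 * euler (q ^ 25) ^ 5 * (1 / rr_cf q ^ 5 - 11
    - rr_cf q ^ 5) * euler (q ^ 25)"
    using euler_norm[OF assms] by simp
  also have "\<dots> = q ^ 5 * (euler (q ^ 25) ^ 5 * euler (q ^ 25)) * (1 / rr_cf q ^ 5 - 11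
    - rr_cf q ^ 5)"
    by (simp only: mult_ac)
  finally show ?thesis by (simp only: flip: power_Suc2) simp
qed

subsection \<open>Eta quotients of level 10\<close>

text \<open>The relation reads \<open>v - u ^ 2 = k * (v + u ^ 2)\<close>, so \<open>k\<close>
  determines \<open>v / u ^ 2\<close>; inserting this into \<open>k = u * v ^ 2\<close> gives
  \<open>u ^ 5\<close>, and everything invariant under the twist becomes rational in
  \<open>k\<close>.\<close>

lemma rr_parametrization:
  fixes u v :: complex
  assumes "u \<noteq> 0" "v \<noteq> 0" "v - u ^ 2 = u * v ^ 2 * (v + u ^ 2)"
  defines "k \<equiv> u * v ^ 2"
  shows "1 + k \<noteq> 0" "1 - k \<noteq> 0" "k \<noteq> 0" "v = u ^ 2 * (1 + k) / (1 - k)"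
    "u ^ 5 = k * (1 - k) ^ 2 / (1 + k) ^ 2" "v ^ 5 = k ^ 2 * (1 + k) / (1 - k)"
    "1 / u ^ 5 - 11 - u ^ 5 = (1 - 4 * k - k ^ 2) ^ 2 * (1 + k - k ^ 2) / (k * (1 - k) ^ 2 * (1
      + k) ^ 2)"
    "1 / v ^ 5 - 11 - v ^ 5 = (1 - 4 * k - k ^ 2) * (1 + k - k ^ 2) ^ 2 / (k ^ 2 * (1 - k) * (1
      + k))"
    "(1 / v ^ 2 - 1 / (u ^ 2 * v)) * (u ^ 2 * v + v ^ 2) = - 4 * (k / ((1 - k) * (1 + k)))"
proof -
  have k: "v - u ^ 2 = k * (v + u ^ 2)" using assms(3) by (simp add: k_def)
  have nz: "v + u ^ 2 \<noteq> 0"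
  proof
    assume "v + u ^ 2 = 0"
    moreover from this have "v - u ^ 2 = 0" using k by simp
    ultimately have "2 * v = 0" by algebra
    thus False using assms(2) by simp
  qed
  have "(1 + k) * (v + u ^ 2) = 2 * v" "(1 - k) * (v + u ^ 2) = 2 * u ^ 2"
    using k by (simp_all add: algebra_simps)
  thus n: "1 + k \<noteq> 0" and m: "1 - k \<noteq> 0" using assms(1,2) by auto
  show k0: "k \<noteq> 0" using assms(1,2) by (simp add: k_def)
  have v0: "v * (1 - k) = u ^ 2 * (1 + k)" using k by (simp add: algebra_simps)
  thus v: "v = u ^ 2 * (1 + k) / (1 - k)" using m by (simp add: field_simps)
  have "k * (1 - k) ^ 2 = u * (v * (1 - k)) ^ 2" by (simp add: k_def power_mult_distrib)
  also have "\<dots> = u ^ 5 * (1 + k) ^ 2" unfolding v0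
    by (simp add: power_mult_distrib eval_nat_numeral)
  finally show u5: "u ^ 5 = k * (1 - k) ^ 2 / (1 + k) ^ 2" using n by (simp add: field_simps)
  have "v ^ 5 = (u ^ 5) ^ 2 * ((1 + k) / (1 - k)) ^ 5"
    unfolding v by (simp add: power_mult_distrib power_divide flip: power_mult)
  also have "\<dots> = k ^ 2 * (1 + k) / (1 - k)"
    unfolding u5 using n m
      by (simp add: divide_simps power_mult_distrib) (simp add: eval_nat_numeral)
  finally show v5: "v ^ 5 = k ^ 2 * (1 + k) / (1 - k)" .
  define M where "M = 1 - k"
  define N where "N = 1 + k"
  have mn: "M \<noteq> 0" "N \<noteq> 0" using m n by (simp_all add: M_def N_def)
  have "N ^ 4 - 11 * (k * M ^ 2 * N ^ 2) - k ^ 2 * M ^ 4 = (1 - 4 * k - k ^ 2) ^ 2 * (1 + k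
    - k ^ 2)"
    unfolding M_def N_def by algebra
  moreover have "1 / (k * M ^ 2 / N ^ 2) - 11 - k * M ^ 2 / N ^ 2 =
      (N ^ 4 - 11 * (k * M ^ 2 * N ^ 2) - k ^ 2 * M ^ 4) / (k * M ^ 2 * N ^ 2)"
    using mn k0 by (simp add: divide_simps) (simp add: algebra_simps eval_nat_numeral)
  ultimately show "1 / u ^ 5 - 11 - u ^ 5 = (1 - 4 * k - k ^ 2) ^ 2 * (1 + k - k ^ 2) / (k * (1
    - k) ^ 2 * (1 + k) ^ 2)"
    unfolding u5 M_def N_def by simp
  have "M ^ 2 - 11 * (k ^ 2 * M * N) - k ^ 4 * N ^ 2 = (1 - 4 * k - k ^ 2) * (1 + k - k ^ 2) ^ 2"
    unfolding M_def N_def by algebra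
  moreover have "1 / (k ^ 2 * N / M) - 11 - k ^ 2 * N / M =
      (M ^ 2 - 11 * (k ^ 2 * M * N) - k ^ 4 * N ^ 2) / (k ^ 2 * M * N)"
    using mn k0 by (simp add: divide_simps) (simp add: algebra_simps eval_nat_numeral)
  ultimately show "1 / v ^ 5 - 11 - v ^ 5 = (1 - 4 * k - k ^ 2) * (1 + k
    - k ^ 2) ^ 2 / (k ^ 2 * (1 - k) * (1 + k))"
    unfolding v5 M_def N_def by simp
  have v': "v = u ^ 2 * N / M" using v by (simp add: M_def N_def)
  have "(1 / v ^ 2 - 1 / (u ^ 2 * v)) * (u ^ 2 * v + v ^ 2) = (u ^ 4 - v ^ 2) / (u ^ 2 * v)"
    using assms(1,2) by (simp add: divide_simps) (simp add: algebra_simps eval_nat_numeral)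
  also have "\<dots> = (M ^ 2 - N ^ 2) / (M * N)"
    unfolding v' using assms(1) mn
      by (simp add: divide_simps) (simp add: algebra_simps eval_nat_numeral)
  also have "M ^ 2 - N ^ 2 = - 4 * k" unfolding M_def N_def by algebra
  finally show "(1 / v ^ 2 - 1 / (u ^ 2 * v)) * (u ^ 2 * v + v ^ 2) = - 4 * (k / ((1 - k) * (1
    + k)))"
    by (simp add: M_def N_def)
qed

text \<open>The eta exponents have weighted sum 10 + 6 - 15 - 1 = 0, so no power of \<open>q\<close>
  occurs in front.\<close>

definition eta_p :: "complex \<Rightarrow> complex" where
  "eta_p q = euler (q ^ 10) * euler (q ^ 2) ^ 3 / (euler (q ^ 5) ^ 3 * euler q)"

lemma rr_obtain:
  assumes "0 < norm q" "norm q < 1"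
  obtains u v k where "u = rr_cf q" "v = rr_cf (q ^ 2)" "u \<noteq> 0" "v \<noteq> 0" "v - u ^ 2 =
    u * v ^ 2 * (v + u ^ 2)" "k = u * v ^ 2"
    "eta_z (q ^ 5) = k / ((1 - k) * (1 + k))"
    "euler (q ^ 5) ^ 6 = q ^ 5 * euler (q ^ 25) ^ 6 * (1 / u ^ 5 - 11 - u ^ 5)"
    "euler (q ^ 10) ^ 6 = q ^ 10 * euler (q ^ 50) ^ 6 * (1 / v ^ 5 - 11 - v ^ 5)"
proof -
  define u where "u = rr_cf q"
  define v where "v = rr_cf (q ^ 2)"
  have q2: "0 < norm (q ^ 2)" "norm (q ^ 2) < 1" using norm_power_less_1[OF assms, of 2] by simp_all
  have nz: "u \<noteq> 0" "v \<noteq> 0" using rr_cf_nonzero[OF assms] rr_cf_nonzero[OF q2]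
    by (auto simp: u_def v_def)
  have rel: "v - u ^ 2 = u * v ^ 2 * (v + u ^ 2)" using theta_part_relations(1)[OF assms]
    by (simp add: u_def v_def)
  have z_eq: "- 4 * eta_z (q ^ 5) = - 4 * (u * v ^ 2 / ((1 - u * v ^ 2) * (1 + u * v ^ 2)))"
    using eta_z_eq_rr_cf[OF assms] rr_parametrization(9)[OF nz rel] by (simp only: u_def v_def)
  show thesis
  proof (rule that[OF u_def v_def nz rel refl])
    show "eta_z (q ^ 5) = u * v ^ 2 / ((1 - u * v ^ 2) * (1 + u * v ^ 2))" using z_eq
      by (simp only: mult_cancel_left) simp
    show "euler (q ^ 5) ^ 6 = q ^ 5 * euler (q ^ 25) ^ 6 * (1 / u ^ 5 - 11 - u ^ 5)"
      using euler_norm_rr_cf[OF assms] by (simp add: u_def)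
    show "euler (q ^ 10) ^ 6 = q ^ 10 * euler (q ^ 50) ^ 6 * (1 / v ^ 5 - 11 - v ^ 5)"
      using euler_norm_rr_cf[OF q2] by (simp add: v_def flip: power_mult)
  qed
qed

text \<open>At a fifth root \<open>q\<close> of \<open>s\<close> the two norm formulas are rational
  in \<open>k\<close>, and in this combination \<open>k\<close> enters only through
  \<open>eta_z s = k / ((1 - k) * (1 + k))\<close>.\<close>

lemma euler_sextic:
  assumes "0 < norm s" "norm s < 1"
  shows "eta_z s \<noteq> 0"
    and "euler s ^ 6 * eta_z s = s * euler (s ^ 5) ^ 6 * ((1 - 4 * eta_z s) ^ 2 * (1 + eta_z s))"
    and "euler (s ^ 2) ^ 6 * eta_z s ^ 2 = s ^ 2 * euler (s ^ 10) ^ 6 * ((1 - 4 * eta_z s) * (1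
      + eta_z s) ^ 2)"
proof -
  define q where "q = exp (Ln s / 5)"
  have q5: "q ^ 5 = s" using assms by (auto simp: q_def simp flip: exp_of_nat_mult)
  have "norm q ^ 5 = norm s" by (simp flip: q5 norm_power)
  hence "norm q < 1" using assms power_less_one_iff[of "norm q" 5] by simp
  moreover have "0 < norm q" by (simp add: q_def)
  ultimately obtain u v k where uv: "u \<noteq> 0" "v \<noteq> 0" "v - u ^ 2 = u * v ^ 2 * (v + u ^ 2)" "k =
    u * v ^ 2"
    and z_eq: "eta_z (q ^ 5) = k / ((1 - k) * (1 + k))"
    and X: "euler (q ^ 5) ^ 6 = q ^ 5 * euler (q ^ 25) ^ 6 * (1 / u ^ 5 - 11 - u ^ 5)"
    and Y: "euler (q ^ 10) ^ 6 = q ^ 10 * euler (q ^ 50) ^ 6 * (1 / v ^ 5 - 11 - v ^ 5)"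
    using rr_obtain[of q] by metis
  note par = rr_parametrization[OF uv(1-3), folded uv(4)]
  define M where "M = 1 - k"
  define N where "N = 1 + k"
  have mn: "M \<noteq> 0" "N \<noteq> 0" "k \<noteq> 0" using par(1-3) by (simp_all add: M_def N_def)
  have z: "eta_z s = k / (M * N)" using z_eq by (simp add: q5 M_def N_def)
  thus "eta_z s \<noteq> 0" using mn by simp
  \<comment> \<open>These rewrite the two quadratic factors of the norms in terms of
    \<open>eta_z s\<close>, which eliminates \<open>k\<close>.\<close>
  have A: "1 - 4 * eta_z s = (1 - 4 * k - k ^ 2) / (M * N)" and B: "1 + eta_z s = (1 + k
    - k ^ 2) / (M * N)"
    unfolding z using mn
      by (simp_all add: field_simps) (simp_all add: M_def N_def algebra_simps power2_eq_square)
  have s: "q ^ 25 = s ^ 5" "q ^ 10 = s ^ 2" "q ^ 50 = s ^ 10"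
    unfolding q5 [symmetric] by (simp_all flip: power_mult)
  show "euler s ^ 6 * eta_z s = s * euler (s ^ 5) ^ 6 * ((1 - 4 * eta_z s) ^ 2 * (1 + eta_z s))"
    using X unfolding A B par(7) s q5 M_def [symmetric] N_def [symmetric]
    using mn by (simp add: z divide_simps) (simp add: eval_nat_numeral mult_ac)
  show "euler (s ^ 2) ^ 6 * eta_z s ^ 2 = s ^ 2 * euler (s ^ 10) ^ 6 * ((1 - 4 * eta_z s) * (1
    + eta_z s) ^ 2)"
    using Y unfolding A B par(8) s q5 M_def [symmetric] N_def [symmetric]
    using mn by (simp add: z divide_simps) (simp add: eval_nat_numeral mult_ac)
qed

text \<open>Both sextic relations involve the unknown \<open>f = 1 - 4 * z\<close>; eliminating it
  expresses \<open>t ^ 3\<close> by Euler products and \<open>z\<close>, and the definition of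
  \<open>z\<close> turns this into the cube of \<open>eta_p\<close>.\<close>

lemma eta_p_cube:
  assumes "0 < norm s" "norm s < 1"
  shows "eta_p s ^ 3 = (1 + eta_z s) ^ 3"
proof -
  define a where "a = euler s"
  define b where "b = euler (s ^ 2)"
  define c where "c = euler (s ^ 5)"
  define d where "d = euler (s ^ 10)"
  define z where "z = eta_z s"
  have nz: "a \<noteq> 0" "b \<noteq> 0" "c \<noteq> 0" "d \<noteq> 0" "s \<noteq> 0"
    using assms euler_nonzero[of s] euler_power_nonzero[of s]
      by (auto simp: a_def b_def c_def d_def)
  note sx = euler_sextic[OF assms, folded a_def b_def c_def d_def z_def]
  have w: "1 - 4 * z \<noteq> 0" using sx(1,2) nz by auto
  have z_eq: "z * (b * c ^ 5) = s * d ^ 5 * a"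
    using nz by (simp add: z_def eta_z_def a_def b_def c_def d_def)
  have p_eq: "eta_p s * (c ^ 3 * a) = d * b ^ 3"
    using nz by (simp add: eta_p_def a_def b_def c_def d_def)
  define t where "t = 1 + z"
  define f where "f = (1 - 4 * z)"
  have 1: "a ^ 6 * z = s * c ^ 6 * (f ^ 2 * t)" and 2: "b ^ 6 * z ^ 2 = s ^ 2 * d ^ 6 * (f * t ^ 2)"
    using sx by (simp_all add: f_def t_def)
  \<comment> \<open>The second relation is squared because it is linear in \<open>f\<close> while
    the first is quadratic; then \<open>f ^ 2\<close> cancels.\<close>
  have "(b ^ 6 * z ^ 2) ^ 2 * (s * c ^ 6 * (f ^ 2 * t)) =
    (s ^ 2 * d ^ 6 * (f * t ^ 2)) ^ 2 * (a ^ 6 * z)"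
    unfolding 1 2 by (simp add: mult_ac)
  hence "(s * z * f ^ 2 * t) * (b ^ 12 * z ^ 3 * c ^ 6) =
    (s * z * f ^ 2 * t) * (s ^ 3 * d ^ 12 * t ^ 3 * a ^ 6)"
    by algebra
  moreover have t: "t \<noteq> 0" using 1 nz sx(1) by auto
  ultimately have 3: "b ^ 12 * z ^ 3 * c ^ 6 = s ^ 3 * d ^ 12 * t ^ 3 * a ^ 6"
    using nz sx(1) w by (simp add: f_def)
  have "(s ^ 3 * d ^ 12 * a ^ 6 * b ^ 3 * c ^ 15) * t ^ 3 =
    b ^ 3 * c ^ 15 * (b ^ 12 * z ^ 3 * c ^ 6)"
    unfolding 3 by (simp add: mult_ac)
  also have "\<dots> = b ^ 12 * c ^ 6 * (z * (b * c ^ 5)) ^ 3"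
    by (simp add: power_mult_distrib mult_ac flip: power_mult)
  also have "\<dots> = (s ^ 3 * d ^ 12 * c ^ 6 * a ^ 3 * b ^ 3) * (d * b ^ 3) ^ 3"
    unfolding z_eq by algebra
  also have "\<dots> = (s ^ 3 * d ^ 12 * c ^ 6 * a ^ 3 * b ^ 3) * (eta_p s * (c ^ 3 * a)) ^ 3"
    unfolding p_eq ..
  also have "\<dots> = (s ^ 3 * d ^ 12 * a ^ 6 * b ^ 3 * c ^ 15) * eta_p s ^ 3"
    by algebra
  finally show ?thesis using nz by (simp add: t_def z_def)
qed

section \<open>Continuity on the disc and extraction of the cube root\<close>

lemma continuous_euler: "continuous_on (ball 0 1) euler"
proof (intro continuous_at_imp_continuous_on ballI)
  fix q :: complex assume "q \<in> ball 0 1"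
  then obtain r where r: "norm q < r" "r < 1" using dense[of "norm q" 1] by auto
  have r0: "0 \<le> r" using r by (meson norm_ge_zero order.strict_implies_order order_le_less_trans)
  have "uniformly_convergent_on (cball 0 r) (\<lambda>N (x::complex). \<Prod>n<N. 1 - x * x ^ n)"
  proof (rule uniformly_convergent_on_prod')
    show "uniformly_convergent_on (cball 0 r) (\<lambda>N (x::complex). \<Sum>n<N. norm (1 - x * x ^ n - 1))"
    proof (rule Weierstrass_m_test_ev[where M = "\<lambda>n. r ^ Suc n", THEN uniformly_convergentI])
      show "\<forall>\<^sub>F n in sequentially. \<forall>x\<in>cball 0 r. norm (norm (1 - x * x ^ n
        - 1 :: complex)) \<le> r ^ Suc n"
        by (intro always_eventually allI ballI) (use r0 in \<open>auto simp: norm_mult norm_power intro!: mult_mono power_mono\<close>)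
      show "summable (\<lambda>n. r ^ Suc n)"
        using r r0 by (simp add: summable_geometric summable_mult)
    qed
  qed (auto intro!: continuous_intros)
  then obtain l where l: "uniform_limit (cball 0 r) (\<lambda>N (x::complex). \<Prod>n<N. 1
    - x * x ^ n) l sequentially"
    by (auto simp: uniformly_convergent_on_def)
  have "l x = euler x" if "x \<in> cball 0 r" for x
  proof (rule LIMSEQ_unique[OF tendsto_uniform_limitI[OF l that]])
    show "(\<lambda>N. \<Prod>n<N. 1 - x * x ^ n) \<longlonglongrightarrow> euler x"
      unfolding euler_def by (rule qpoch_LIMSEQ) (use that r in auto)
  qed
  hence "uniform_limit (cball 0 r) (\<lambda>N x. \<Prod>n<N. 1 - x * x ^ n) euler sequentially"
    using l by (simp add: uniform_limit_iff)
  hence "continuous_on (cball 0 r) euler"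
    by (rule uniform_limit_theorem[rotated]) (auto intro!: always_eventually continuous_intros)
  thus "isCont euler q"
    by (rule continuous_on_interior) (use r in auto)
qed

lemma euler_0: "euler 0 = 1"
  by (simp add: euler_def qpoch_def)

text \<open>
  The sixth powers in \<open>euler_sextic\<close> determine \<open>eta_p\<close> only up to a cube root of unity.
  That root is a continuous function on the unit disc, hence constant, and it is \<open>1\<close> at the origin.
\<close>

lemma eta_p_eq_1_plus_eta_z:
  assumes "0 < norm s" "norm s < 1"
  shows "eta_p s = 1 + eta_z s"
proof -
  have cont: "continuous_on (ball 0 1) (\<lambda>q. euler (q ^ n))" if "n > 0" for n
    by (rule continuous_on_compose2[OF continuous_euler])
       (use that in \<open>auto intro!: continuous_intros simp: norm_power power_less_one_iff\<close>)
  have nz: "euler (q ^ n) \<noteq> 0" if "q \<in> ball 0 1" "n > 0" for q n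
    using euler_power_nonzero[of q n] that by simp
  have p_eq: "continuous_on (ball 0 1) eta_p" and z_eq: "continuous_on (ball 0 1) eta_z"
    unfolding eta_p_def [abs_def] eta_z_def [abs_def] using nz[of _ 1]
    by (auto intro!: continuous_intros cont continuous_euler simp: nz)
  have 0: "eta_p 0 = 1" "eta_z 0 = 0" by (simp_all add: eta_p_def eta_z_def euler_0)
  \<comment> \<open>Off the origin this comes from the cube identity, as \<open>eta_p\<close> is a
    quotient of nonzero Euler products.\<close>
  have nz1: "1 + eta_z q \<noteq> 0" if "q \<in> ball 0 1" for q
  proof (cases "q = 0")
    case False
    have "eta_p q \<noteq> 0" using nz[OF that] nz[OF that, of 1] by (simp add: eta_p_def)
    thus ?thesis using eta_p_cube[of q] False that by auto
  qed (simp add: 0)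
  define h where "h q = eta_p q / (1 + eta_z q)" for q
  have "h q ^ 3 = 1" if "q \<in> ball 0 1" for q
    using eta_p_cube[of q] that nz1[OF that] by (cases "q = 0") (auto simp: h_def power_divide 0)
  hence "h ` ball 0 1 \<subseteq> {z. z ^ 3 = 1}" by auto
  hence "finite (h ` ball 0 1)" by (rule finite_subset) (auto intro: finite_nth_roots)
  moreover have "continuous_on (ball 0 1) h"
    unfolding h_def by (intro continuous_intros p_eq z_eq) (use nz1 in auto)
  ultimately have "h constant_on ball 0 1"
    by (intro continuous_finite_range_constant) (auto intro: convex_connected)
  hence "h s = h 0" unfolding constant_on_def using assms
    by (metis centre_in_ball mem_ball_0 zero_less_one)
  thus ?thesis using nz1[of s] assms by (simp add: h_def 0)
qed

text \<open>The quotient of the two sextic relations gives \<open>f / t\<close> as an eta quotient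
  times a power of \<open>s\<close>. Since \<open>t\<close> is exactly \<open>eta_p s\<close>, and
  not only up to a cube root of unity, \<open>f\<close> is an eta quotient too, and the claim
  becomes a cancellation.\<close>

lemma eta_y_eq_eta_z:
  assumes "0 < norm s" "norm s < 1"
  shows "eta_y s * (1 - 4 * eta_z s) = eta_z s"
proof -
  define a where "a = euler s"
  define b where "b = euler (s ^ 2)"
  define c where "c = euler (s ^ 5)"
  define d where "d = euler (s ^ 10)"
  define z where "z = eta_z s"
  have nz: "a \<noteq> 0" "b \<noteq> 0" "c \<noteq> 0" "d \<noteq> 0" "s \<noteq> 0"
    using assms euler_nonzero[of s] euler_power_nonzero[of s]
      by (auto simp: a_def b_def c_def d_def)
  define t where "t = 1 + z"
  define f where "f = (1 - 4 * z)"
  note sx = euler_sextic[OF assms, folded a_def b_def c_def d_def z_def, folded t_def f_def]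
  have t: "t \<noteq> 0" "f \<noteq> 0" using sx(1,2) nz by auto
  have z_eq: "z = s * d ^ 5 * a / (b * c ^ 5)"
    by (simp add: z_def eta_z_def a_def b_def c_def d_def)
  have p_eq: "t = d * b ^ 3 / (c ^ 3 * a)"
    using eta_p_eq_1_plus_eta_z[OF assms]
      by (simp add: t_def z_def eta_p_def a_def b_def c_def d_def)
  have "(a ^ 6 * z) * (s ^ 2 * d ^ 6 * (f * t ^ 2)) = (s * c ^ 6 * (f ^ 2 * t)) * (b ^ 6 * z ^ 2)"
    unfolding sx by (simp add: mult_ac)
  hence "(s * f * t * z) * (a ^ 6 * s * d ^ 6 * t) = (s * f * t * z) * (c ^ 6 * f * b ^ 6 * z)"
    by (simp add: power2_eq_square mult_ac)
  hence "a ^ 6 * s * d ^ 6 * t = c ^ 6 * f * b ^ 6 * z" using t sx(1) nz by simp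
  hence "f = a ^ 6 * s * d ^ 6 * t / (c ^ 6 * b ^ 6 * z)" using nz sx(1) by (simp add: field_simps)
  also have "\<dots> = a ^ 4 * d ^ 2 / (b ^ 2 * c ^ 4)"
    unfolding z_eq p_eq using nz by (simp add: divide_simps) (simp add: eval_nat_numeral mult_ac)
  finally have "f = a ^ 4 * d ^ 2 / (b ^ 2 * c ^ 4)" .
  moreover have "eta_y s = s * b * d ^ 3 / (a ^ 3 * c)"
    by (simp add: eta_y_def a_def b_def c_def d_def)
  ultimately have "eta_y s * f =
    (s * b * d ^ 3 / (a ^ 3 * c)) * (a ^ 4 * d ^ 2 / (b ^ 2 * c ^ 4))" by simp
  also have "\<dots> = z"
    unfolding z_eq using nz by (simp add: divide_simps) (simp add: eval_nat_numeral mult_ac)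
  finally have "eta_y s * f = z" .
  thus ?thesis by (simp add: f_def z_def)
qed

subsection \<open>The quintic\<close>

text \<open>Substituting \<open>y = k / A\<close> and clearing \<open>A ^ 5\<close> makes the
  coefficient of index \<open>j\<close> a polynomial in \<open>k\<close> divisible by
  \<open>B ^ (4 - j)\<close>. These powers of \<open>B\<close> later balance the powers of
  \<open>eta_y q\<close>.\<close>

lemma a_poly_homogeneous:
  fixes A B k y :: complex
  assumes "A = 1 - 4 * k - k ^ 2" "B = 1 + k - k ^ 2" "A \<noteq> 0" "y * A = k"
  shows "poly (a_poly 0) y * A ^ 5 = k * B ^ 4 * (- 1)"
    and "poly (a_poly 1) y * A ^ 5 = k * B ^ 3 * (- 15 - 20 * k + 15 * k ^ 2)"
    and "poly (a_poly 2) y * A ^ 5 = k * B ^ 2 * (- 85 - 220 * k + 10 * k ^ 2 + 220 * k ^ 3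
      - 85 * k ^ 4)"
    and "poly (a_poly 3) y * A ^ 5 = k * B * (- 215 - 820 * k - 475 * k ^ 2 + 1000 * k ^ 3
      + 475 * k ^ 4 - 820 * k ^ 5 + 215 * k ^ 6)"
    and "poly (a_poly 4) y * A ^ 5 = k * (- 205 - 1020 * k - 1260 * k ^ 2 + 1140 * k ^ 3
      + 1650 * k ^ 4 - 1140 * k ^ 5 - 1260 * k ^ 6 + 1020 * k ^ 7 - 205 * k ^ 8)"
proof -
  define f where "f i = y ^ i * A ^ 5" for i
  have f: "f (Suc i) = k ^ Suc i * A ^ (5 - Suc i)" if "i < 5" for i
  proof -
    have "A ^ 5 = A ^ Suc i * A ^ (5 - Suc i)" using that by (simp flip: power_add power_Suc)
    thus ?thesis unfolding f_def assms(4) [symmetric] by (simp only: power_mult_distrib mult.assoc)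
  qed
  have f1: "y * A ^ 5 = k * A ^ 4" "y ^ 2 * A ^ 5 = k ^ 2 * A ^ 3" "y ^ 3 * A ^ 5 = k ^ 3 * A ^ 2"
    "y ^ 4 * A ^ 5 = k ^ 4 * A" "y ^ 5 * A ^ 5 = k ^ 5"
    using f[of 0] f[of 1] f[of 2] f[of 3] f[of 4] by (simp_all add: f_def eval_nat_numeral)
  have "poly (a_poly 0) y * A ^ 5 = - 1 * (y * A ^ 5) - 20 * (y ^ 2 * A ^ 5)
    - 150 * (y ^ 3 * A ^ 5) - 500 * (y ^ 4 * A ^ 5) - 625 * (y ^ 5 * A ^ 5)"
    by (simp add: a_poly_def algebra_simps eval_nat_numeral)
  also have "\<dots> = k * B ^ 4 * (- 1)"
    unfolding f1 unfolding assms(1,2) by algebra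
  finally show "poly (a_poly 0) y * A ^ 5 = k * B ^ 4 * (- 1)" .
  have "poly (a_poly 1) y * A ^ 5 = - 15 * (y * A ^ 5) - 305 * (y ^ 2 * A ^ 5)
    - 2325 * (y ^ 3 * A ^ 5) - 7875 * (y ^ 4 * A ^ 5) - 10000 * (y ^ 5 * A ^ 5)"
    by (simp add: a_poly_def algebra_simps eval_nat_numeral)
  also have "\<dots> = k * B ^ 3 * (- 15 - 20 * k + 15 * k ^ 2)"
    unfolding f1 unfolding assms(1,2) by algebra
  finally show "poly (a_poly 1) y * A ^ 5 = k * B ^ 3 * (- 15 - 20 * k + 15 * k ^ 2)" .
  have "poly (a_poly 2) y * A ^ 5 = - 85 * (y * A ^ 5) - 1750 * (y ^ 2 * A ^ 5)
    - 13525 * (y ^ 3 * A ^ 5) - 46500 * (y ^ 4 * A ^ 5) - 60000 * (y ^ 5 * A ^ 5)"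
    by (simp add: a_poly_def algebra_simps eval_nat_numeral)
  also have "\<dots> = k * B ^ 2 * (- 85 - 220 * k + 10 * k ^ 2 + 220 * k ^ 3 - 85 * k ^ 4)"
    unfolding f1 unfolding assms(1,2) by algebra
  finally show "poly (a_poly 2) y * A ^ 5 = k * B ^ 2 * (- 85 - 220 * k + 10 * k ^ 2 + 220 * k ^ 3
    - 85 * k ^ 4)" .
  have "poly (a_poly 3) y * A ^ 5 = - 215 * (y * A ^ 5) - 4475 * (y ^ 2 * A ^ 5)
    - 35000 * (y ^ 3 * A ^ 5) - 122000 * (y ^ 4 * A ^ 5) - 160000 * (y ^ 5 * A ^ 5)"
    by (simp add: a_poly_def algebra_simps eval_nat_numeral)
  also have "\<dots> = k * B * (- 215 - 820 * k - 475 * k ^ 2 + 1000 * k ^ 3 + 475 * k ^ 4 - 820 * k ^ 5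
    + 215 * k ^ 6)"
    unfolding f1 unfolding assms(1,2) by algebra
  finally show "poly (a_poly 3) y * A ^ 5 = k * B * (- 215 - 820 * k - 475 * k ^ 2 + 1000 * k ^ 3
    + 475 * k ^ 4 - 820 * k ^ 5 + 215 * k ^ 6)" .
  have "poly (a_poly 4) y * A ^ 5 = - 205 * (y * A ^ 5) - 4300 * (y ^ 2 * A ^ 5)
    - 34000 * (y ^ 3 * A ^ 5) - 120000 * (y ^ 4 * A ^ 5) - 160000 * (y ^ 5 * A ^ 5)"
    by (simp add: a_poly_def algebra_simps eval_nat_numeral)
  also have "\<dots> = k * (- 205 - 1020 * k - 1260 * k ^ 2 + 1140 * k ^ 3 + 1650 * k ^ 4 - 1140 * k ^ 5
    - 1260 * k ^ 6 + 1020 * k ^ 7 - 205 * k ^ 8)"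
    unfolding f1 unfolding assms(1,2) by algebra
  finally show "poly (a_poly 4) y * A ^ 5 = k * (- 205 - 1020 * k - 1260 * k ^ 2 + 1140 * k ^ 3
    + 1650 * k ^ 4 - 1140 * k ^ 5 - 1260 * k ^ 6 + 1020 * k ^ 7 - 205 * k ^ 8)" .
qed

text \<open>
  Here \<open>x\<close> is \<open>(1 + k - k^2) / y(q)\<close>, written in the basis \<open>1, u, u^2, u^3, 1/u\<close> over the
  rational functions of \<open>k\<close>. The multiples \<open>b1, \<dots>, b4\<close> of \<open>u, u^2, u^3, 1/u\<close> are
  scaled such that the only denominator in their multiplication table is \<open>k\<close>.
\<close>

lemma rr_quintic:
  fixes k u :: complex
  assumes "k \<noteq> 0" "1 - k \<noteq> 0" "1 + k \<noteq> 0" "u ^ 5 = k * (1 - k) ^ 2 / (1 + k) ^ 2" "u \<noteq> 0"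
  defines "v \<equiv> u ^ 2 * (1 + k) / (1 - k)"
  defines "x \<equiv> - 3 - 4 * k + 3 * k ^ 2 + (1 + k) ^ 2 * u + 2 * (1 + k) * u ^ 2
      + 2 * ((1 + k) ^ 2 * u ^ 3 / (1 - k)) + (1 - k) ^ 2 / u"
  shows "(1 / v - 1 - v) * x = (1 - k) * (1 + k) * (1 / u - 1 - u) ^ 3"
    and "(1 + k - k ^ 2) * (1 - 4 * k - k ^ 2) ^ 5 + k * ((- 205 - 1020 * k - 1260 * k ^ 2
      + 1140 * k ^ 3 + 1650 * k ^ 4 - 1140 * k ^ 5 - 1260 * k ^ 6 + 1020 * k ^ 7
        - 205 * k ^ 8) * x + (- 215 - 820 * k - 475 * k ^ 2 + 1000 * k ^ 3 + 475 * k ^ 4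
          - 820 * k ^ 5 + 215 * k ^ 6) * x ^ 2 + (- 85 - 220 * k + 10 * k ^ 2 + 220 * k ^ 3
            - 85 * k ^ 4) * x ^ 3 + (- 15 - 20 * k + 15 * k ^ 2) * x ^ 4 - x ^ 5) = 0"
proof -
  define m where "m = 1 - k"
  define n where "n = 1 + k"
  define j where "j = 1 / k"
  define b1 where "b1 = n * u"
  define b2 where "b2 = n * u ^ 2"
  define b3 where "b3 = n ^ 2 * u ^ 3 / m"
  define b4 where "b4 = m / u"
  define C where "C x0 x1 x2 x3 x4 = x0 + x1 * b1 + x2 * b2 + x3 * b3 + x4 * b4" for x0 x1 x2 x3 x4
  have nz: "m \<noteq> 0" "n \<noteq> 0" using assms by (simp_all add: m_def n_def)
  \<comment> \<open>Keeping \<open>1 / k\<close> as a symbol \<open>j\<close> with this relation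
    makes the coordinates polynomial; it enters through \<open>b4 * b4\<close>, where
    \<open>1 / u ^ 2\<close> is \<open>u ^ 3 / u ^ 5\<close>.\<close>
  have jk: "j * k = 1" using assms by (simp add: j_def)
  have u5: "u ^ 5 * n ^ 2 = k * m ^ 2" using assms nz unfolding m_def n_def
    by (simp add: field_simps)
  have tab: "b1 * b1 = n * b2" "b1 * b2 = m * b3" "b1 * b3 = n * k * b4" "b1 * b4 = n * m"
     "b2 * b2 = k * m * b4" "b2 * b3 = n * k * m" "b2 * b4 = m * b1"
     "b3 * b3 = n * k * b1" "b3 * b4 = n * b2" "b4 * b4 = m * j * b3"
  proof -
    have b: "b1 = n * u" "b2 = n * u ^ 2" "b3 * m = n ^ 2 * u ^ 3" "b4 * u = m" "b4 * (k * m) =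
      n ^ 2 * u ^ 4"
      using nz assms(5) u5
        by (simp_all add: b1_def b2_def b3_def b4_def field_simps eval_nat_numeral)
    show "b1 * b1 = n * b2" unfolding b by algebra
    show "b1 * b2 = m * b3" using b by algebra
    show "b1 * b4 = n * m" using b by algebra
    show "b2 * b4 = m * b1" using b by algebra
    show "b2 * b2 = k * m * b4" using b by algebra
    have "m * (b2 * b3) = m * (n * k * m)" using b u5 by algebra
    thus "b2 * b3 = n * k * m" using nz by simp
    have "m * (b1 * b3) = m * (n * k * b4)" using b u5 by algebra
    thus "b1 * b3 = n * k * b4" using nz by simp
    have "m ^ 2 * (b3 * b3) = m ^ 2 * (n * k * b1)" using b u5 by algebra
    thus "b3 * b3 = n * k * b1" using nz by simp
    have "m * (b3 * b4) = m * (n * b2)" using b u5 by algebra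
    thus "b3 * b4 = n * b2" using nz by simp
    have "(k * m) * (b4 * b4) = (k * m) * (m * j * b3)" using b u5 jk by algebra
    thus "b4 * b4 = m * j * b3" using nz assms(1) by simp
  qed
  have mult: "C x0 x1 x2 x3 x4 * C y0 y1 y2 y3 y4 =
     C (x0 * y0 + n * m * (x1 * y4 + x4 * y1) + n * k * m * (x2 * y3 + x3 * y2))
       (x0 * y1 + x1 * y0 + m * (x2 * y4 + x4 * y2) + n * k * (x3 * y3))
       (x0 * y2 + x2 * y0 + n * (x1 * y1) + n * (x3 * y4 + x4 * y3))
       (x0 * y3 + x3 * y0 + m * (x1 * y2 + x2 * y1) + m * j * (x4 * y4))
       (x0 * y4 + x4 * y0 + n * k * (x1 * y3 + x3 * y1) + k * m * (x2 * y2))"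
         for x0 x1 x2 x3 x4 y0 y1 y2 y3 y4
    unfolding C_def using tab by algebra
  \<comment> \<open>Identities below are proved coordinate by coordinate.\<close>
  have eqI: "C x0 x1 x2 x3 x4 = C y0 y1 y2 y3 y4"
    if "x0 = y0" "x1 = y1" "x2 = y2" "x3 = y3" "x4 = y4" for x0 x1 x2 x3 x4 y0 y1 y2 y3 y4
    using that by simp
  have x: "x = C (- 3 - 4 * k + 3 * k ^ 2)
          (1 + k)
          (2)
          (2)
          (1 - k)"
    unfolding x_def C_def b1_def b2_def b3_def b4_def m_def n_def by (simp add: power2_eq_square)
  have x2: "x ^ 2 = C (11 + 32 * k - 6 * k ^ 2 - 32 * k ^ 3 + 11 * k ^ 4)
          (- 2 - 18 * k + 6 * k ^ 2 + 6 * k ^ 3)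
          (- 7 - 13 * k + 11 * k ^ 2 + k ^ 3)
          (j * (1 - 11 * k - 13 * k ^ 2 + 7 * k ^ 3))
          (- 6 + 6 * k + 18 * k ^ 2 - 2 * k ^ 3)"
    unfolding power2_eq_square x mult unfolding m_def n_def
      by (rule eqI; (algebra | use jk in algebra))
  have "x ^ 3 = x ^ 2 * x" "x ^ 4 = x ^ 2 * x ^ 2" "x ^ 5 = x ^ 4 * x"
    by (simp_all add: eval_nat_numeral)
  note pow = this
  have x3: "x ^ 3 = C (- 39 - 192 * k - 75 * k ^ 2 + 320 * k ^ 3 + 75 * k ^ 4 - 192 * k ^ 5
    + 39 * k ^ 6)
          (110 * k + 80 * k ^ 2 - 220 * k ^ 3 + 30 * k ^ 5)
          (j * (1 + 18 * k + 95 * k ^ 2 + 20 * k ^ 3 - 105 * k ^ 4 + 58 * k ^ 5 + 9 * k ^ 6))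
          (j * (- 9 + 58 * k + 105 * k ^ 2 + 20 * k ^ 3 - 95 * k ^ 4 + 18 * k ^ 5 - k ^ 6))
          (30 - 220 * k ^ 2 - 80 * k ^ 3 + 110 * k ^ 4)"
    unfolding pow(1) x2 unfolding x mult unfolding m_def n_def
      by (rule eqI; (algebra | use jk in algebra))
  have x4: "x ^ 4 = C (131 + 1024 * k + 1012 * k ^ 2 - 2048 * k ^ 3 - 2030 * k ^ 4 + 2048 * k ^ 5
    + 1012 * k ^ 6 - 1024 * k ^ 7 + 131 * k ^ 8)
          (j * (1 + 19 * k - 463 * k ^ 2 - 1213 * k ^ 3 + 1395 * k ^ 4 + 2033 * k ^ 5
            - 1453 * k ^ 6 - 199 * k ^ 7 + 136 * k ^ 8))
          (j * (- 12 - 18 * k - 454 * k ^ 2 - 714 * k ^ 3 + 410 * k ^ 4 + 154 * k ^ 5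
            - 834 * k ^ 6 + 258 * k ^ 7 + 58 * k ^ 8))
          (j * (58 - 258 * k - 834 * k ^ 2 - 154 * k ^ 3 + 410 * k ^ 4 + 714 * k ^ 5 - 454 * k ^ 6
            + 18 * k ^ 7 - 12 * k ^ 8))
          (- 136 - 199 * k + 1453 * k ^ 2 + 2033 * k ^ 3 - 1395 * k ^ 4 - 1213 * k ^ 5
            + 463 * k ^ 6 + 19 * k ^ 7 - k ^ 8)"
    unfolding pow(2) x2 mult unfolding m_def n_def by (rule eqI; (algebra | use jk in algebra))
  have x5: "x ^ 5 = C (j * (1 - 419 * k - 4966 * k ^ 2 - 8785 * k ^ 3 + 10895 * k ^ 4
    + 22306 * k ^ 5 - 12884 * k ^ 6 - 22306 * k ^ 7 + 10895 * k ^ 8 + 8785 * k ^ 9 - 4966 * k ^ 10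
      + 419 * k ^ 11 + k ^ 12))
          (j * (- 15 - 80 * k + 1515 * k ^ 2 + 8880 * k ^ 3 - 1190 * k ^ 4 - 27120 * k ^ 5
            + 2310 * k ^ 6 + 21520 * k ^ 7 - 7035 * k ^ 8 - 1920 * k ^ 9 + 575 * k ^ 10))
          (j * (95 - 145 * k + 1460 * k ^ 2 + 6420 * k ^ 3 + 2890 * k ^ 4 - 2550 * k ^ 5
            + 5140 * k ^ 6 + 1780 * k ^ 7 - 6065 * k ^ 8 + 895 * k ^ 9 + 320 * k ^ 10))
          (j * (- 320 + 895 * k + 6065 * k ^ 2 + 1780 * k ^ 3 - 5140 * k ^ 4 - 2550 * k ^ 5
            - 2890 * k ^ 6 + 6420 * k ^ 7 - 1460 * k ^ 8 - 145 * k ^ 9 - 95 * k ^ 10))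
          (575 + 1920 * k - 7035 * k ^ 2 - 21520 * k ^ 3 + 2310 * k ^ 4 + 27120 * k ^ 5
            - 1190 * k ^ 6 - 8880 * k ^ 7 + 1515 * k ^ 8 + 80 * k ^ 9 - 15 * k ^ 10)"
    unfolding pow(3) x4 unfolding x mult unfolding m_def n_def
      by (rule eqI; (algebra | use jk in algebra))
  have lin: "c * C x0 x1 x2 x3 x4 = C (c * x0) (c * x1) (c * x2) (c * x3) (c * x4)"
    "C x0 x1 x2 x3 x4 + C y0 y1 y2 y3 y4 = C (x0 + y0) (x1 + y1) (x2 + y2) (x3 + y3) (x4 + y4)"
    for c x0 x1 x2 x3 x4 y0 y1 y2 y3 y4
    by (simp_all add: C_def algebra_simps)
  \<comment> \<open>The quintic is evaluated in coordinates, and each of its five coordinates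
    vanishes.\<close>
  have "C ((1 + k - k ^ 2) * (1 - 4 * k - k ^ 2) ^ 5) 0 0 0 0 +
      (k * (- 205 - 1020 * k - 1260 * k ^ 2 + 1140 * k ^ 3 + 1650 * k ^ 4 - 1140 * k ^ 5
        - 1260 * k ^ 6 + 1020 * k ^ 7 - 205 * k ^ 8) * x + (k * (- 215 - 820 * k - 475 * k ^ 2
          + 1000 * k ^ 3 + 475 * k ^ 4 - 820 * k ^ 5 + 215 * k ^ 6) * x ^ 2 + (k * (- 85 - 220 * k
            + 10 * k ^ 2 + 220 * k ^ 3 - 85 * k ^ 4) * x ^ 3 + (k * (- 15 - 20 * k
              + 15 * k ^ 2) * x ^ 4 + - k * x ^ 5))))
      = C 0 0 0 0 0"
    unfolding x5 x4 x3 x2 unfolding x lin by (rule eqI; (algebra | use jk in algebra))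
  thus "(1 + k - k ^ 2) * (1 - 4 * k - k ^ 2) ^ 5 + k * ((- 205 - 1020 * k - 1260 * k ^ 2
    + 1140 * k ^ 3 + 1650 * k ^ 4 - 1140 * k ^ 5 - 1260 * k ^ 6 + 1020 * k ^ 7 - 205 * k ^ 8) * x
      + (- 215 - 820 * k - 475 * k ^ 2 + 1000 * k ^ 3 + 475 * k ^ 4 - 820 * k ^ 5
        + 215 * k ^ 6) * x ^ 2 + (- 85 - 220 * k + 10 * k ^ 2 + 220 * k ^ 3 - 85 * k ^ 4) * x ^ 3
          + (- 15 - 20 * k + 15 * k ^ 2) * x ^ 4 - x ^ 5) = 0"
    by (simp add: C_def algebra_simps eval_nat_numeral)
  define m' where "m' = 1 / m"
  define n' where "n' = 1 / n"
  have inv: "m' * (1 - k) = 1" "n' * (1 + k) = 1"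
    using nz by (simp_all add: m'_def n'_def flip: m_def n_def)
  \<comment> \<open>The coordinates of \<open>1 / v - 1 - v\<close> and
    \<open>1 / u - 1 - u\<close>. In the first, \<open>1 / v = m / (n * u ^ 2)\<close> becomes a
    multiple of \<open>b3\<close> through the value of \<open>u ^ 5\<close>.\<close>
  define d where "d = C (- 1) 0 (- m') (j * n') 0"
  define e where "e = C (- 1) (- n') 0 0 m'"
  have "1 / v = j / n * b3"
    using u5 nz assms(1,5) unfolding v_def b3_def j_def m_def [symmetric] n_def [symmetric]
    by (simp add: divide_simps) (simp add: eval_nat_numeral mult_ac)
  moreover have "v = b2 / m" by (simp add: v_def b2_def m_def n_def)
  ultimately have d: "1 / v - 1 - v = d" by (simp add: d_def C_def m'_def n'_def)
  have e: "1 / u - 1 - u = e"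
    using nz by (simp add: e_def C_def b1_def b4_def m'_def n'_def)
  have "d * x = C (m * n) 0 0 0 0 * (e * e * e)"
    unfolding d_def e_def x mult unfolding m_def n_def
    by (rule eqI; (algebra | use jk inv in algebra))
  thus "(1 / v - 1 - v) * x = (1 - k) * (1 + k) * (1 / u - 1 - u) ^ 3"
    by (simp add: d e C_def m_def n_def power3_eq_cube)
qed

text \<open>Two descriptions meet here: \<open>w = k / A\<close> for the value at
  \<open>q ^ 5\<close>, and \<open>y = B / x\<close> for the value at \<open>q\<close>, where
  \<open>x\<close> satisfies the quintic of \<open>rr_quintic\<close>.\<close>

lemma eta_y_modular_equation:
  assumes "0 < norm q" "norm q < 1"
  shows "eta_y q ^ 5 + (\<Sum>j=0..4. poly (a_poly j) (eta_y (q ^ 5)) * eta_y q ^ j) = 0"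
proof -
  obtain u v k where uv: "u = rr_cf q" "v = rr_cf (q ^ 2)" "u \<noteq> 0" "v \<noteq> 0" "v - u ^ 2 =
    u * v ^ 2 * (v + u ^ 2)"
      "k = u * v ^ 2" and z_eq: "eta_z (q ^ 5) = k / ((1 - k) * (1 + k))"
    using rr_obtain[OF assms] by metis
  note par = rr_parametrization[OF uv(3-5), folded uv(6)]
  have q2: "0 < norm (q ^ 2)" "norm (q ^ 2) < 1" and q5: "0 < norm (q ^ 5)" "norm (q ^ 5) < 1"
    using norm_power_less_1[OF assms, of 2] norm_power_less_1[OF assms, of 5] by simp_all
  define A where "A = 1 - 4 * k - k ^ 2"
  define B where "B = 1 + k - k ^ 2"
  define y where "y = eta_y q"
  define w where "w = eta_y (q ^ 5)"
  define d where "d = 1 / u - 1 - u"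
  define e where "e = 1 / v - 1 - v"
  define mn where "mn = (1 - k) * (1 + k)"
  have mn: "mn \<noteq> 0" using par by (simp add: mn_def)
  have e1: "euler q = q * euler (q ^ 25) * d"
    using euler_eq_rr_cf[OF assms] by (simp add: d_def uv)
  have e2: "euler (q ^ 2) = q ^ 2 * euler (q ^ 50) * e"
    using euler_eq_rr_cf[OF q2] by (simp add: e_def uv flip: power_mult)
  have nz: "q \<noteq> 0" "euler (q ^ 5) \<noteq> 0" "euler (q ^ 10) \<noteq> 0" "euler (q ^ 25) \<noteq> 0" "euler (q ^ 50) \<noteq> 0"
    using assms euler_power_nonzero[of q] by auto
  have de: "d \<noteq> 0" "e \<noteq> 0"
    using e1 e2 euler_nonzero[of q] euler_nonzero[of "q ^ 2"] assms q2 by auto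
  have z: "1 - 4 * eta_z (q ^ 5) = A / mn" "1 + eta_z (q ^ 5) = B / mn"
    using mn unfolding z_eq A_def B_def mn_def
    by (simp_all add: field_simps) (simp_all add: algebra_simps power2_eq_square)
  have wA: "w * A = k"
    using eta_y_eq_eta_z[OF q5] mn unfolding z unfolding z_eq
      by (simp add: w_def mn_def [symmetric])
  have A0: "A \<noteq> 0" using wA par(3) by auto
  have p_eq: "eta_p (q ^ 5) = B / mn" using eta_p_eq_1_plus_eta_z[OF q5] by (simp add: z)
  moreover have "eta_p (q ^ 5) \<noteq> 0"
    using nz by (simp add: eta_p_def flip: power_mult)
  ultimately have B0: "B \<noteq> 0" by auto
  \<comment> \<open>Inserting \<open>e1\<close> and \<open>e2\<close> into the quotient, the powers
    of \<open>q\<close> cancel and the Euler products left over form \<open>eta_p\<close> at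
    \<open>q ^ 5\<close>.\<close>
  have "y = eta_p (q ^ 5) * (e / d ^ 3)"
    unfolding y_def eta_y_def eta_p_def e1 e2 using nz de
    by (simp add: divide_simps power_mult_distrib flip: power_mult) (simp add: power2_eq_square power3_eq_cube)
  hence y: "y * (mn * d ^ 3) = B * e" using mn de by (simp add: p_eq)
  define x where "x = - 3 - 4 * k + 3 * k ^ 2 + (1 + k) ^ 2 * u + 2 * (1 + k) * u ^ 2
      + 2 * ((1 + k) ^ 2 * u ^ 3 / (1 - k)) + (1 - k) ^ 2 / u"
  note quintic = rr_quintic[OF par(3) par(2) par(1) par(5) uv(3), folded par(4), folded x_def]
  have "e * x = mn * d ^ 3" using quintic(1) by (simp add: e_def d_def mn_def)
  hence "e * (x * y) = e * B" using y by algebra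
  hence xy: "x * y = B" using de by simp
  have x0: "x \<noteq> 0" using xy B0 by auto
  note ap = a_poly_homogeneous[OF A_def B_def A0 wA]
  define c0 :: complex where "c0 = - 1"
  define c1 where "c1 = - 15 - 20 * k + 15 * k ^ 2"
  define c2 where "c2 = - 85 - 220 * k + 10 * k ^ 2 + 220 * k ^ 3 - 85 * k ^ 4"
  define c3 where "c3 = - 215 - 820 * k - 475 * k ^ 2 + 1000 * k ^ 3 + 475 * k ^ 4 - 820 * k ^ 5
    + 215 * k ^ 6"
  define c4 where "c4 = - 205 - 1020 * k - 1260 * k ^ 2 + 1140 * k ^ 3 + 1650 * k ^ 4
    - 1140 * k ^ 5 - 1260 * k ^ 6 + 1020 * k ^ 7 - 205 * k ^ 8"
  define S where "S = y ^ 5 + (\<Sum>j=0..4. poly (a_poly j) w * y ^ j)"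
  have "S * A ^ 5 = y ^ 5 * A ^ 5 + poly (a_poly 0) w * A ^ 5 + (poly (a_poly 1) w * A ^ 5) * y
      + (poly (a_poly 2) w * A ^ 5) * y ^ 2 + (poly (a_poly 3) w * A ^ 5) * y ^ 3
        + (poly (a_poly 4) w * A ^ 5) * y ^ 4"
    unfolding S_def by (simp add: numeral_eq_Suc sum.atLeast0_atMost_Suc algebra_simps)
  also have "\<dots> = y ^ 5 * A ^ 5 + k * B ^ 4 * c0 + k * B ^ 3 * c1 * y
      + k * B ^ 2 * c2 * y ^ 2 + k * B * c3 * y ^ 3 + k * c4 * y ^ 4"
    unfolding ap c0_def c1_def c2_def c3_def c4_def ..
  finally have S: "S * A ^ 5 = \<dots>" .
  have q: "B * A ^ 5 + k * (c4 * x + c3 * x ^ 2 + c2 * x ^ 3 + c1 * x ^ 4 - x ^ 5) = 0"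
    using quintic(2) unfolding A_def B_def c1_def c2_def c3_def c4_def .
  \<comment> \<open>Replacing \<open>x * y\<close> by \<open>B\<close> gives every term the factor
    \<open>B ^ 4\<close>, and what remains is the quintic for \<open>x\<close>.\<close>
  have "S * A ^ 5 * x ^ 5 = B ^ 4 * (B * A ^ 5 + k * (c4 * x + c3 * x ^ 2 + c2 * x ^ 3
    + c1 * x ^ 4 - x ^ 5))"
    unfolding S c0_def xy [symmetric] by algebra
  hence "S = 0" unfolding q using A0 x0 by simp
  thus ?thesis by (simp add: S_def y_def w_def)
qed

theorem theorem2p4:
  fixes \<tau> :: complex
  assumes "Im \<tau> > 0"
  shows "y_fun \<tau> ^ 5 + (\<Sum>j=0..4. a_fun j (5 * \<tau>) * y_fun \<tau> ^ j) = 0"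
proof -
  \<comment> \<open>Multiplying the argument by 5 raises the nome to the fifth power, so the claim
    is the modular equation at \<open>q = nome \<tau>\<close>.\<close>
  have "nome (5 * \<tau>) = nome \<tau> ^ 5"
    by (simp add: nome_def mult_ac flip: exp_of_nat_mult)
  moreover have "0 < norm (nome \<tau>)" by (simp add: nome_def)
  ultimately show ?thesis
    using eta_y_modular_equation[of "nome \<tau>"] norm_nome[OF assms] assms
    by (simp add: a_fun_def y_fun_eq_eta_y)
qed

end
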